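(* Consider the elastoplastic system $(D,A,\prod_j[c_j^-,c_j^+],R,l(t))$ and the associated objects $d$, $P$, $n_j$, $\mathcal{V}$, $\mathcal{V}_{basis}$, $c(t)$, $C$, $C(t)$ described in the context. Let $I_0\subset\{-1,1\}\times\{1,\dots,m\}$ with $|I_0|=d$ be such that there is a unique $y_{*,0}\in\mathcal{V}$ with $\langle e_j,Ay_{*,0}\rangle=c_j^\alpha$ for all $(\alpha,j)\in I_0$, and let $F=\{y_{*,0}\}$. Let $\tau_d>0$ and assume that $$\begin{pmatrix}1\\0_{m-n+1}\end{pmatrix}l'(t)\in{\rm cone}\big(P\{\alpha e_j:(\alpha,j)\in I_0\}\big)\quad\text{for a.a. }t\in[0,\tau_d],$$ that $c_j^-<\langle e_j,Ay_{*,0}\rangle<c_j^+$ for every $j$ not occurring in $I_0$, and that $\varepsilon_0>0$ satisfies $\varepsilon_0\le\bar\varepsilon_0(t)$ for a.a. $t\in[0,\tau_d]$, where $$\bar\varepsilon_0(t)=\min_{(\alpha_*,j_* )\in I_0}{\rm dist}^A\Big(-c'(t),\,{\rm span}\{n_j:(\alpha,j)\in I_0\setminus\{(\alpha_*,j_* )\}\}\Big).$$ If $$\tau_d\ge\frac1{\varepsilon_0}\cdot\|A^{-1}c^+-A^{-1}c^-\|^A,$$ then $$-\dot c(t)+B^A_{\varepsilon_0}(0)\cap N^A_F(y)\subset N^A_C(y)\quad\text{for all }y\in F\text{ and a.a. }t\in[0,\tau_d],$$ and, in particular, the solutions $y$ of the sweeping process $-\dot y(t)\in N^A_{C(t)}(y(t))$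 with any initial conditions $y(0)\in C(0)$ satisfy $y(\tau_d)=y_{*,0}+c(\tau_d)$. Accordingly, the stress vector $s(t)$ of the elastoplastic system satisfies $s(\tau_d)=Ay_{*,0}$ regardless of the initial value $s(0)$. Therefore, if $c(t)$ is $T$-periodic with $T\ge\tau_d$, then the solution $y_*(t)$ with the initial condition $y_*(\tau_d)=y_{*,0}+c(\tau_d)$ is a one-period stable $T$-periodic solution of the sweeping process, and the stress vector $s(t)$ exhibits a unique $T$-periodic behavior beginning at the time $\tau_d$ (i.e. for $t\ge\tau_d$, $s(t)$ is $T$-periodic and is the same function for all initial values).
   Context: Setting: $m\ge n\ge2$; $D$ is an $m\times n$ matrix (kinematic matrix of a connected network of $m$ springs on $n$ nodes) with ${\rm rank}\,D=n-1$; $A={\rm diag}(a_1,\dots,a_m)$ with all $a_j>0$; $c_j^-\le c_j^+$ are the elastic limits of spring $j$, $c^\pm=(c_1^\pm,\dots,c_m^\pm)^T$; $R\in\mathbb{R}^m$ with ${\rm rank}(D^TR)=1$; $l:[0,\infty)\to\mathbb{R}$ is the Lipschitz displacement-controlled loading. Put $d=m-n+2$. Choose: an $n\times(n-2)$-matrix $Q$ with ${\rm rank}(DQ)=n-2$ and $R^TDQ=0$; an $m\times d$-matrix $\mathcal{V}_{basis}$ with linearly independent columns and $(DQ)^TA\mathcal{V}_{basis}=0$; an $m\times(m-n+1)$-matrix $D^\perp$ of rank $m-n+1$ with $(D^\perp)^TD=0$. Let $P=\begin{pmatrix}R^T\\(D^\perp)^T\end{pmatrix}$ ($d\times m$), $W=P\,\mathcal{V}_{basis}$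 (invertible $d\times d$), $\mathcal{V}=\mathcal{V}_{basis}\mathbb{R}^d$ with scalar product $(x,y)_A=\langle x,Ay\rangle$, $n_j=\mathcal{V}_{basis}W^{-1}Pe_j$ (one has $\langle e_j,Ay\rangle=\langle n_j,Ay\rangle$ for $y\in\mathcal{V}$), and $c(t)=-\mathcal{V}_{basis}W^{-1}\begin{pmatrix}1\\0_{m-n+1}\end{pmatrix}l(t)$. Here $e_j$ is the standard basis of $\mathbb{R}^m$ and $c_j^\alpha=c_j^{\pm}$ for $\alpha=\pm1$. $C=\{y\in\mathcal{V}:c_j^-\le\langle e_j,Ay\rangle\le c_j^+,\ j=1,\dots,m\}$, $C(t)=C+c(t)$. A solution of the sweeping process is a locally absolutely continuous $\mathcal{V}$-valued function with $y(t)\in C(t)$ for all $t$ satisfying the inclusion a.e. The stress vector is $s(t)=A(y(t)-c(t))$. ${\rm cone}(S)$ is the set of nonnegative linear combinations of elements of $S$. $\|x\|^A=\sqrt{\langle x,Ax\rangle}$, ${\rm dist}^A$ is the distance in this norm (with ${\rm span}\,\emptyset=\{0\}$); $B^A_\varepsilon(0)=\{x\in\mathcal{V}:\|x\|^A\le\varepsilon\}$; for closed convex $K\subset\mathcal{V}$, $N^A_K(y)=\{x\in\mathcal{V}:\langle x,A(\xi-y)\rangle\le0\ \forall\xi\in K\}$ if $y\in K$ and $\emptyset$ otherwise. "One-period stable $T$-periodic solution" means that $y_*(t+T)=y_*(t)$ for $t\ge\tau_d$ and every solution with $y(0)\in C(0)$ coincides with $y_*$ for all $t\ge T$. *)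

theory Defs
  imports "HOL-Analysis.Analysis"
begin

definition diag_matrix :: "real^'m \<Rightarrow> real^'m^'m" where
  "diag_matrix a = (\<chi> i j. if i = j then a $ i else 0)"

definition norm_A :: "real^'m^'m \<Rightarrow> real^'m \<Rightarrow> real" where
  "norm_A A x = sqrt (x \<bullet> (A *v x))"

definition dist_A :: "real^'m^'m \<Rightarrow> real^'m \<Rightarrow> (real^'m) set \<Rightarrow> real" where
  "dist_A A x S = (INF s\<in>S. norm_A A (x - s))"

definition ball_A :: "real^'m^'m \<Rightarrow> (real^'m) set \<Rightarrow> real \<Rightarrow> (real^'m) set" where
  "ball_A A V \<epsilon> = {x \<in> V. norm_A A x \<le> \<epsilon>}"

definition normal_cone_A ::
  "real^'m^'m \<Rightarrow> (real^'m) set \<Rightarrow> (real^'m) set \<Rightarrow> real^'m \<Rightarrow> (real^'m) set" where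
  "normal_cone_A A V K y =
     (if y \<in> K then {x \<in> V. \<forall>\<xi>\<in>K. x \<bullet> (A *v (\<xi> - y)) \<le> 0} else {})"

text \<open>The library's \<open>cone hull S\<close> consists of the multiples of single elements of \<open>S\<close> only.\<close>

definition nonneg_combinations :: "'a::real_vector set \<Rightarrow> 'a set" where
  "nonneg_combinations S =
     {\<Sum>x\<in>X. u x *\<^sub>R x | X u. finite X \<and> X \<subseteq> S \<and> (\<forall>x\<in>X. 0 \<le> u x)}"

definition abs_continuous_on :: "real set \<Rightarrow> (real \<Rightarrow> 'a::metric_space) \<Rightarrow> bool" where
  "abs_continuous_on S f \<longleftrightarrow>
     (\<forall>\<epsilon>>0. \<exists>\<delta>>0. \<forall>N::nat. \<forall>u v :: nat \<Rightarrow> real.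
        (\<forall>i<N. u i \<le> v i \<and> {u i..v i} \<subseteq> S) \<longrightarrow>
        (\<forall>i<N. \<forall>j<N. i \<noteq> j \<longrightarrow> {u i<..<v i} \<inter> {u j<..<v j} = {}) \<longrightarrow>
        (\<Sum>i<N. v i - u i) < \<delta> \<longrightarrow>
        (\<Sum>i<N. dist (f (u i)) (f (v i))) < \<epsilon>)"

definition locally_abs_continuous_from :: "real \<Rightarrow> (real \<Rightarrow> 'a::metric_space) \<Rightarrow> bool" where
  "locally_abs_continuous_from t0 f \<longleftrightarrow> (\<forall>b\<ge>t0. abs_continuous_on {t0..b} f)"

definition sweeping_solution ::
  "real^'m^'m \<Rightarrow> (real^'m) set \<Rightarrow> (real \<Rightarrow> (real^'m) set) \<Rightarrow> real \<Rightarrow> (real \<Rightarrow> real^'m) \<Rightarrow> bool" where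
  "sweeping_solution A V K t0 y \<longleftrightarrow>
     locally_abs_continuous_from t0 y \<and>
     (\<forall>t\<ge>t0. y t \<in> V \<and> y t \<in> K t) \<and>
     (AE t\<in>{t0..} in lebesgue. \<exists>y'. (y has_vector_derivative y') (at t) \<and>
        - y' \<in> normal_cone_A A V (K t) (y t))"

definition one_period_stable ::
  "real^'m^'m \<Rightarrow> (real^'m) set \<Rightarrow> (real \<Rightarrow> (real^'m) set) \<Rightarrow> real \<Rightarrow> real \<Rightarrow> (real \<Rightarrow> real^'m) \<Rightarrow> bool" where
  "one_period_stable A V K \<tau> T z \<longleftrightarrow>
     (\<forall>t\<ge>\<tau>. z (t + T) = z t) \<and>
     (\<forall>y. sweeping_solution A V K 0 y \<and> y 0 \<in> K 0 \<longrightarrow> (\<forall>t\<ge>T. y t = z t))"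

text \<open>
  The columns of the matrix \<open>Dperp\<close> are indexed by a type \<open>'k\<close> with \<open>m - n + 1\<close> elements, so that
  \<open>'k option\<close> has \<open>d = m - n + 2\<close> elements. In \<open>\<real>\<^sup>d\<close> the index \<open>None\<close> is the first coordinate,
  the one that belongs to the row \<open>R\<^sup>T\<close> of \<open>P\<close>.
\<close>

definition P_matrix :: "real^'m \<Rightarrow> real^'k^'m \<Rightarrow> real^'m^('k::finite option)" where
  "P_matrix R Dperp = (\<chi> i. case i of None \<Rightarrow> R | Some k \<Rightarrow> column k Dperp)"

definition W_inv :: "real^'m \<Rightarrow> real^'k^'m \<Rightarrow> real^('k option)^'m \<Rightarrow> real^('k option)^('k::finite option)" where
  "W_inv R Dperp Vbasis = matrix_inv (P_matrix R Dperp ** Vbasis)"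

definition spring_normal ::
  "real^'m \<Rightarrow> real^'k^'m \<Rightarrow> real^('k::finite option)^'m \<Rightarrow> 'm \<Rightarrow> real^'m" where
  "spring_normal R Dperp Vbasis j =
     Vbasis *v (W_inv R Dperp Vbasis *v (P_matrix R Dperp *v axis j 1))"

definition load_shift ::
  "real^'m \<Rightarrow> real^'k^'m \<Rightarrow> real^('k::finite option)^'m \<Rightarrow> (real \<Rightarrow> real) \<Rightarrow> real \<Rightarrow> real^'m" where
  "load_shift R Dperp Vbasis l t =
     - (Vbasis *v (W_inv R Dperp Vbasis *v (l t *\<^sub>R axis None 1)))"

definition elastic_limit :: "real^'m \<Rightarrow> real^'m \<Rightarrow> real \<Rightarrow> 'm \<Rightarrow> real" where
  "elastic_limit cm cp \<alpha> j = (if \<alpha> = 1 then cp $ j else cm $ j)"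

definition elastic_set ::
  "real^'m^'m \<Rightarrow> (real^'m) set \<Rightarrow> real^'m \<Rightarrow> real^'m \<Rightarrow> (real^'m) set" where
  "elastic_set A V cm cp =
     {y \<in> V. \<forall>j. cm $ j \<le> axis j 1 \<bullet> (A *v y) \<and> axis j 1 \<bullet> (A *v y) \<le> cp $ j}"

definition stress :: "real^'m^'m \<Rightarrow> (real \<Rightarrow> real^'m) \<Rightarrow> (real \<Rightarrow> real^'m) \<Rightarrow> real \<Rightarrow> real^'m" where
  "stress A c y t = A *v (y t - c t)"

end

theory Submission
  imports Defs
begin

text \<open>
  The distance hypothesis says that \<open>-c'(t)\<close> lies at distance at least \<open>\<epsilon>0\<close> from every facet of the cone
  generated by the outer normals \<open>\<alpha> n\<^sub>j\<close>, \<open>(\<alpha>, j) \<in> I0\<close>, so \<open>-c'(t)\<close> plus an \<open>\<epsilon>0\<close>-ball stays in that cone, hence in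
  the normal cone of \<open>C\<close> at the corner \<open>y0\<close>. Along a solution the distance from \<open>y(t) - c(t)\<close> to \<open>y0\<close> therefore
  decreases at rate at least \<open>\<epsilon>0\<close> until it vanishes, and initially it is at most the \<open>A\<close>-norm of
  \<open>A\<^sup>-\<^sup>1 c\<^sup>+ - A\<^sup>-\<^sup>1 c\<^sup>-\<close>. The dissipation inequality gives uniqueness, and comparing a solution with its
  translate by \<open>T\<close> gives periodicity.

  Existence of the solution uses Moreau's catching-up scheme. On a finite set of times it satisfies
  a quadratic variational inequality without any error term, so Tychonoff's theorem yields a
  Lipschitz function that satisfies it at all times; at points of differentiability this
  inequality is the inclusion.
\<close>

subsection \<open>Lipschitz functions are differentiable almost everywhere\<close>

text \<open>Solutions are merely absolutely continuous and the inclusion holds only almost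
  everywhere, so two facts about the real line carry the analysis. A Lipschitz function is
  differentiable almost everywhere, which makes the limit of the catching-up scheme a solution. An
  absolutely continuous function whose derivative is almost everywhere nonpositive does not
  increase, which turns pointwise dissipation into a statement about intervals. All estimates are
  Euclidean, because the square root of \<open>A\<close> carries the energy scalar product
  isometrically to the standard one. The corner enters through its uniqueness: no nonzero vector of
  \<open>V\<close> is \<open>A\<close>-orthogonal to all normals indexed by \<open>I0\<close>, so
  these span \<open>V\<close>, and every perturbation of \<open>-c'\<close> inside \<open>V\<close>
  is a combination of them. The condition \<open>T \<ge> \<tau>d\<close> makes the translate by
  \<open>T\<close> of a solution started at \<open>\<tau>d\<close> a solution on the whole half-line
  from 0, so it too is driven into the corner by time \<open>\<tau>d\<close>.\<close>

lemma lmeasurable_outer_open: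
  fixes S :: "'a::euclidean_space set"
  assumes S: "S \<in> lmeasurable" and "e > 0"
  obtains U where "open U" "S \<subseteq> U" "U \<in> lmeasurable"
    "measure lebesgue U < measure lebesgue S + e"
proof -
  obtain U where U: "open U" "S \<subseteq> U" "U - S \<in> lmeasurable" "emeasure lebesgue (U - S) < ennreal e"
    using sets_lebesgue_outer_open[OF fmeasurableD[OF S] \<open>e > 0\<close>] by metis
  have eq: "U = S \<union> (U - S)" using U(2) by blast
  have "measure lebesgue (U - S) < e"
    using U(3,4) \<open>e > 0\<close> by (simp add: emeasure_eq_measure2 ennreal_less_iff)
  moreover have "measure lebesgue U = measure lebesgue S + measure lebesgue (U - S)"
    by (subst eq, rule measure_Un_AE) (use S U(3) in \<open>auto intro: AE_I2\<close>)
  moreover have "U \<in> lmeasurable"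
    using eq S U(3) by (metis fmeasurable.Un)
  ultimately show thesis using that U(1,2) by fastforce
qed

text \<open>A weak form of Lebesgue's density theorem. Cover a bounded piece of \<open>E\<close> by
  non-overlapping intervals whose union exceeds it by at most \<open>e\<close> in measure. A
  fraction \<open>\<kappa>\<close> of every interval belongs to the excess, so any finite subfamily
  has total length at most \<open>e / \<kappa>\<close>.\<close>

lemma negligible_if_uniformly_sparse:
  fixes E :: "real set"
  assumes E: "E \<in> sets lebesgue" and "0 < \<kappa>"
    and sparse: "\<And>u v. u \<le> v \<Longrightarrow> \<kappa> * (v - u) \<le> measure lebesgue ({u..v} - E)"
  shows "negligible E"
proof -
  have "negligible (E \<inter> cbox a b)" for a b :: real
  proof -
    define S where "S = E \<inter> cbox a b"
    have S: "S \<in> lmeasurable"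
      unfolding S_def using E
      by (metis bounded_Int bounded_cbox bounded_set_imp_lmeasurable sets.Int lmeasurable_cbox fmeasurableD)
    \<comment> \<open>The term \<open>e / \<kappa>\<close> bounds a finite subfamily of the cover;
      the other \<open>e\<close> is the price of truncating the countable cover to it.\<close>
    have bound: "measure lebesgue S \<le> e + e / \<kappa>" if "e > 0" for e
    proof -
      obtain \<D> where D: "countable \<D>"
        "\<And>K. K \<in> \<D> \<Longrightarrow> K \<subseteq> cbox a b \<and> K \<noteq> {} \<and> (\<exists>c d. K = cbox c d)"
        "pairwise (\<lambda>A B. interior A \<inter> interior B = {}) \<D>"
        "S \<subseteq> \<Union>\<D>" "\<Union>\<D> \<in> lmeasurable" "measure lebesgue (\<Union>\<D>) \<le> measure lebesgue S + e"
        using measurable_outer_intervals_bounded[of S a b e] S \<open>e > 0\<close> unfolding S_def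
        by (metis inf_le2)
      have DK: "K \<in> lmeasurable" if "K \<in> \<D>" for K
        using D(2)[OF that] by auto
      have "\<And>D'. \<lbrakk>D' \<subseteq> \<D>; finite D'\<rbrakk> \<Longrightarrow> measure lebesgue (\<Union>D') \<le> measure lebesgue (\<Union>\<D>)"
        by (intro measure_mono_fmeasurable Union_mono D(5) sets.finite_Union)
           (use DK fmeasurableD in blast)+
      then obtain D' where D': "D' \<subseteq> \<D>" "finite D'"
        "measure lebesgue (\<Union>\<D>) - e < measure lebesgue (\<Union>D')"
        using measure_countable_Union_approachable[OF D(1) \<open>e > 0\<close> DK] by metis
      have "\<kappa> * measure lebesgue (\<Union>D') \<le> \<kappa> * (\<Sum>K\<in>D'. measure lebesgue K)"
        using D' DK \<open>0 < \<kappa>\<close> measure_Union_le[of D' lebesgue]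
        by (intro mult_left_mono) (auto intro!: measure_Union_le fmeasurableD)
      also have "\<dots> = (\<Sum>K\<in>D'. \<kappa> * measure lebesgue K)"
        by (rule sum_distrib_left)
      also have "\<dots> \<le> (\<Sum>K\<in>D'. measure lebesgue (K - S))"
      proof (rule sum_mono)
        fix K assume "K \<in> D'"
        then obtain c d where K: "K = {c..d}" "c \<le> d" "K \<subseteq> cbox a b"
          using D(2)[of K] D'(1) by fastforce
        have "K - S = {c..d} - E"
          using K by (auto simp: S_def)
        then show "\<kappa> * measure lebesgue K \<le> measure lebesgue (K - S)"
          using sparse[OF K(2)] K by simp
      qed
      also have "\<dots> = measure lebesgue (\<Union>K\<in>D'. K - S)"
      proof (rule measure_negligible_finite_Union_image[symmetric])
        show "pairwise (\<lambda>x y. negligible ((x - S) \<inter> (y - S))) D'"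
        proof (rule pairwiseI)
          fix K L assume *: "K \<in> D'" "L \<in> D'" "K \<noteq> L"
          then have "interior K \<inter> interior L = {}"
            using D(3) D'(1) by (auto simp: pairwise_def)
          moreover obtain c d c' d' where "K = cbox c d" "L = cbox c' d'"
            using * D(2) D'(1) by (meson subsetD)
          ultimately have "K \<inter> L \<subseteq> {c, d, c', d'}"
            using * by (auto simp: )
          then show "negligible ((K - S) \<inter> (L - S))"
            by (intro negligible_subset[OF negligible_finite[of "{c, d, c', d'}"]]) auto
        qed
      qed (use D' DK S in auto)
      also have "\<dots> \<le> measure lebesgue (\<Union>\<D> - S)"
        using D' DK D(5) S
        by (intro measure_mono_fmeasurable) (auto intro!: sets.finite_UN sets.Diff fmeasurableD)
      also have "\<dots> = measure lebesgue (\<Union>\<D>) - measure lebesgue S"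
        using D S by (intro measurable_measure_Diff) auto
      also have "\<dots> \<le> e" using D by simp
      finally have "measure lebesgue (\<Union>D') \<le> e / \<kappa>"
        using \<open>0 < \<kappa>\<close> by (simp add: field_simps)
      moreover have "measure lebesgue S \<le> measure lebesgue (\<Union>\<D>)"
        using D S by (intro measure_mono_fmeasurable) auto
      ultimately show ?thesis using D'(3) by linarith
    qed
    have "measure lebesgue S \<le> 0"
    proof (rule field_le_epsilon)
      fix e :: real assume "e > 0"
      have "1 + 1 / \<kappa> > 0" using \<open>0 < \<kappa>\<close> by (simp add: add_pos_pos)
      moreover have "e / (1 + 1 / \<kappa>) + e / (1 + 1 / \<kappa>) / \<kappa> = e / (1 + 1 / \<kappa>) * (1 + 1 / \<kappa>)"
        by (simp add: distrib_left)
      ultimately show "measure lebesgue S \<le> 0 + e"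
        using bound[of "e / (1 + 1/\<kappa>)"] \<open>e > 0\<close> by simp
    qed
    then show ?thesis
      using S by (metis S_def measure_nonneg order_antisym negligible_iff_measure)
  qed
  then show ?thesis
    using negligible_on_intervals[of E] by blast
qed

text \<open>Meant for \<open>\<sigma> = 1\<close> (derivative from the right) and \<open>\<sigma> = -1\<close> (from the left).\<close>

definition upper_dini_set :: "(real \<Rightarrow> real) \<Rightarrow> real \<Rightarrow> real \<Rightarrow> real set" where
  "upper_dini_set f \<sigma> q = {x. \<forall>\<delta>>0. \<exists>h. 0 < h \<and> h < \<delta> \<and> q * h < \<sigma> * (f (x + \<sigma> * h) - f x)}"

text \<open>By continuity the condition is open in \<open>x\<close> for each fixed \<open>h\<close>,
  so the uncountable union over \<open>h\<close> is open. Only the bounds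
  \<open>1 / real (Suc n)\<close> on \<open>h\<close> have to be intersected, which gives a G-delta
  set.\<close>

lemma upper_dini_set_measurable:
  assumes "continuous_on UNIV f"
  shows "upper_dini_set f \<sigma> q \<in> sets lebesgue"
proof -
  have "upper_dini_set f \<sigma> q =
    (\<Inter>n. \<Union>h\<in>{0<..<1 / real (Suc n)}. {x. q * h < \<sigma> * (f (x + \<sigma> * h) - f x)})"
    (is "_ = (\<Inter>n. ?U n)")
  proof (intro subset_antisym subsetI)
    fix x assume x: "x \<in> upper_dini_set f \<sigma> q"
    show "x \<in> (\<Inter>n. ?U n)"
    proof (rule INT_I)
      fix n
      have "0 < 1 / real (Suc n)" by simp
      then obtain h where "0 < h" "h < 1 / real (Suc n)" "q * h < \<sigma> * (f (x + \<sigma> * h) - f x)"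
        using x unfolding upper_dini_set_def by blast
      then show "x \<in> ?U n" by (intro UN_I[of h]) (simp_all del: of_nat_Suc)
    qed
  next
    fix x assume *: "x \<in> (\<Inter>n. ?U n)"
    show "x \<in> upper_dini_set f \<sigma> q"
      unfolding upper_dini_set_def
    proof (intro CollectI allI impI)
      fix \<delta> :: real assume "\<delta> > 0"
      obtain n where "1 / real (Suc n) < \<delta>"
        using nat_approx_posE[OF \<open>\<delta> > 0\<close>] by blast
      moreover have "x \<in> ?U n" using * by blast
      then obtain h where "0 < h" "h < 1 / real (Suc n)" "q * h < \<sigma> * (f (x + \<sigma> * h) - f x)"
        by (auto simp del: of_nat_Suc)
      ultimately show "\<exists>h. 0 < h \<and> h < \<delta> \<and> q * h < \<sigma> * (f (x + \<sigma> * h) - f x)"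
        by (meson less_trans)
    qed
  qed
  moreover have "open {x. q * h < \<sigma> * (f (x + \<sigma> * h) - f x)}" for h
    by (intro open_Collect_less continuous_intros continuous_on_compose2[OF assms]) auto
  then have "open (?U n)" for n by blast
  then have "(\<Inter>n. ?U n) \<in> sets borel"
    by (intro sets.countable_INT) (auto intro: borel_open)
  ultimately show ?thesis by simp
qed

text \<open>By continuity the last point where \<open>g\<close> is at least \<open>g u\<close>
  exists; were it to the left of \<open>v\<close>, the hypothesis would supply a later one.\<close>

lemma increment_ge_if_right_recurrent:
  fixes g :: "real \<Rightarrow> real"
  assumes "u \<le> v" "continuous_on {u..v} g"
    and ex: "\<And>x. u \<le> x \<Longrightarrow> x < v \<Longrightarrow> \<exists>y. x < y \<and> y \<le> v \<and> g x \<le> g y"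
  shows "g u \<le> g v"
proof -
  define S where "S = {x \<in> {u..v}. g u \<le> g x}"
  have "closed S"
    unfolding S_def by (intro continuous_on_closed_Collect_le) (use assms in auto)
  have S: "u \<in> S" "bdd_above S" using assms(1) by (auto simp: S_def)
  then have "Sup S \<in> S"
    using \<open>closed S\<close> by (intro closed_contains_Sup) auto
  then have s: "u \<le> Sup S" "Sup S \<le> v" "g u \<le> g (Sup S)" by (auto simp: S_def)
  have "Sup S = v"
  proof (rule ccontr)
    assume "Sup S \<noteq> v"
    then obtain y where "Sup S < y" "y \<le> v" "g (Sup S) \<le> g y" using ex s by fastforce
    then have "y \<in> S" using s by (auto simp: S_def)
    then show False using \<open>Sup S < y\<close> S(2) cSup_upper by fastforce
  qed
  then show ?thesis using s by simp
qed

lemma increment_ge_if_left_recurrent: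
  fixes g :: "real \<Rightarrow> real"
  assumes "u \<le> v" "continuous_on {u..v} g"
    and ex: "\<And>x. u < x \<Longrightarrow> x \<le> v \<Longrightarrow> \<exists>y. y < x \<and> u \<le> y \<and> g y \<le> g x"
  shows "g u \<le> g v"
proof -
  have "(\<lambda>x. - g (- x)) (- v) \<le> (\<lambda>x. - g (- x)) (- u)"
  proof (rule increment_ge_if_right_recurrent[where g = "\<lambda>x. - g (- x)"])
    show "continuous_on {- v..- u} (\<lambda>x. - g (- x))"
      by (intro continuous_intros continuous_on_compose2[OF assms(2)]) auto
    fix x assume "- v \<le> x" "x < - u"
    then obtain y where "y < - x" "u \<le> y" "g y \<le> g (- x)" using ex[of "- x"] by auto
    then show "\<exists>y>x. y \<le> - u \<and> - g (- x) \<le> - g (- y)"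
      by (intro exI[of _ "- y"]) auto
  qed (use assms(1) in simp)
  then show ?thesis by simp
qed

text \<open>The rising-sun argument is run on \<open>f x - q x + (K + \<bar>q\<bar>) \<mu>(H \<inter> [u, x])\<close>, where the open set \<open>H\<close> covers \<open>[u, v] - E\<close>:
  the last term compensates the slope of \<open>f\<close> at the points outside \<open>E\<close>.\<close>

lemma increment_ge_on_upper_dini_set:
  fixes f :: "real \<Rightarrow> real"
  assumes lip: "K-lipschitz_on UNIV f" and E: "E \<in> sets lebesgue" "E \<subseteq> upper_dini_set f \<sigma> q"
    and \<sigma>: "\<sigma> = 1 \<or> \<sigma> = -1" and "u \<le> v"
  shows "q * (v - u) - (K + \<bar>q\<bar>) * measure lebesgue ({u..v} - E) \<le> f v - f u"
proof -
  define K' where "K' = K + \<bar>q\<bar>"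
  have "K \<ge> 0" using lip by (rule lipschitz_on_nonneg)
  then have K': "K' \<ge> 0" by (simp add: K'_def)
  have meas: "{u..v} - E \<in> lmeasurable"
    using E by (intro bounded_set_imp_lmeasurable) (auto intro: bounded_diff)
  have bound: "q * (v - u) - K' * (measure lebesgue ({u..v} - E) + e) \<le> f v - f u" if "e > 0" for e
  proof -
    obtain H where H: "open H" "{u..v} - E \<subseteq> H" "H \<in> lmeasurable"
      "measure lebesgue H < measure lebesgue ({u..v} - E) + e"
      using lmeasurable_outer_open[OF meas \<open>e > 0\<close>] by metis
    define m where "m x = measure lebesgue (H \<inter> {u..x})" for x
    have Hm: "H \<inter> {s..t} \<in> lmeasurable" for s t
      using H(3) by (intro fmeasurable.Int) auto
    have m: "m y = m x + measure lebesgue (H \<inter> {x<..y})" if "u \<le> x" "x \<le> y" for x y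
    proof -
      have "H \<inter> {u..y} = (H \<inter> {u..x}) \<union> (H \<inter> {x<..y})" using that by auto
      moreover have "H \<inter> {x<..y} = H \<inter> {u..y} - H \<inter> {u..x}" using that by auto
      then have "H \<inter> {x<..y} \<in> lmeasurable" using Hm by (metis fmeasurable.Diff)
      ultimately show ?thesis unfolding m_def
        by (simp only:, intro measure_Un_AE) (use Hm in \<open>auto intro: AE_I2\<close>)
    qed
    have m_mono: "m x \<le> m y" if "u \<le> x" "x \<le> y" for x y
      using m[OF that] by simp
    have m_lip: "m y \<le> m x + (y - x)" if "u \<le> x" "x \<le> y" for x y
    proof -
      have "measure lebesgue (H \<inter> {x<..y}) \<le> measure lebesgue {x..y}"
        using H(3) by (intro measure_mono_fmeasurable) auto
      then show ?thesis using m[OF that] that by simp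
    qed
    have m_eq: "m y = m x + (y - x)" if "u \<le> x" "x \<le> y" "{x..y} \<subseteq> H" for x y
    proof -
      have "H \<inter> {x<..y} = {x<..y}" using that(3) by auto
      then show ?thesis using m[OF that(1,2)] that by simp
    qed
    have "1-lipschitz_on {u..v} m"
    proof (rule lipschitz_onI)
      fix x y assume "x \<in> {u..v}" "y \<in> {u..v}"
      then show "dist (m x) (m y) \<le> 1 * dist x y"
        using m_mono[of x y] m_lip[of x y] m_mono[of y x] m_lip[of y x]
        by (cases "x \<le> y") (auto simp: dist_real_def)
    qed simp
    then have contm: "continuous_on {u..v} m" by (rule lipschitz_on_continuous_on)
    define g where "g x = f x - q * x + K' * m x" for x
    have contf: "continuous_on {u..v} f"
      using lipschitz_on_continuous_on[OF lip] continuous_on_subset by blast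
    have contg: "continuous_on {u..v} g"
      unfolding g_def by (intro continuous_intros contf contm)
    have "g u \<le> g v"
      using \<sigma>
    proof
      assume \<sigma>: "\<sigma> = 1"
      show ?thesis
      proof (rule increment_ge_if_right_recurrent[OF \<open>u \<le> v\<close> contg])
        fix x assume x: "u \<le> x" "x < v"
        show "\<exists>y>x. y \<le> v \<and> g x \<le> g y"
        proof (cases "x \<in> E")
          case True
          then have "x \<in> upper_dini_set f 1 q" using E(2) \<sigma> by blast
          moreover have "v - x > 0" using x by simp
          ultimately obtain h where "0 < h" "h < v - x" "q * h < 1 * (f (x + 1 * h) - f x)"
            unfolding upper_dini_set_def by blast
          then have "g x \<le> g (x + h)"
            using m_mono[of x "x + h"] x mult_left_mono[OF m_mono[of x "x + h"] K']
            by (simp add: g_def algebra_simps)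
          then show ?thesis using \<open>0 < h\<close> \<open>h < v - x\<close> by (intro exI[of _ "x + h"]) auto
        next
          case False
          then have "x \<in> H" using x H by auto
          then obtain \<epsilon> where \<epsilon>: "\<epsilon> > 0" "cball x \<epsilon> \<subseteq> H"
            using H(1) open_contains_cball by blast
          define h where "h = min \<epsilon> (v - x)"
          have h: "h > 0" "x + h \<le> v" "h \<le> \<epsilon>" using x \<epsilon> by (auto simp: h_def)
          have "{x..x+h} \<subseteq> H" using \<epsilon>(2) h by (auto simp: cball_def dist_real_def subset_iff)
          \<comment> \<open>On an interval inside \<open>H\<close> the correction grows by
            \<open>(K + \<bar>q\<bar>) * h\<close>, the largest loss that \<open>f x - q * x\<close>
            can suffer there.\<close>
          then have "m (x + h) = m x + h" using m_eq[of x "x+h"] x h by auto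
          moreover have "\<bar>f (x + h) - f x\<bar> \<le> K * h"
            using lipschitz_onD[OF lip, of "x+h" x] h by (simp add: dist_real_def)
          moreover have "q * h \<le> \<bar>q\<bar> * h" using h by (simp add: mult_right_mono)
          ultimately have "g x \<le> g (x + h)"
            by (simp add: g_def K'_def algebra_simps)
          then show ?thesis using h by (intro exI[of _ "x + h"]) auto
        qed
      qed
    next
      assume \<sigma>: "\<sigma> = -1"
      show ?thesis
      proof (rule increment_ge_if_left_recurrent[OF \<open>u \<le> v\<close> contg])
        fix x assume x: "u < x" "x \<le> v"
        show "\<exists>y<x. u \<le> y \<and> g y \<le> g x"
        proof (cases "x \<in> E")
          case True
          then have "x \<in> upper_dini_set f (-1) q" using E(2) \<sigma> by blast
          moreover have "x - u > 0" using x by simp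
          ultimately obtain h where "0 < h" "h < x - u" "q * h < -1 * (f (x + -1 * h) - f x)"
            unfolding upper_dini_set_def by blast
          then have "g (x - h) \<le> g x"
            using x mult_left_mono[OF m_mono[of "x - h" x] K']
            by (simp add: g_def algebra_simps)
          then show ?thesis using \<open>0 < h\<close> \<open>h < x - u\<close> by (intro exI[of _ "x - h"]) auto
        next
          case False
          then have "x \<in> H" using x H by auto
          then obtain \<epsilon> where \<epsilon>: "\<epsilon> > 0" "cball x \<epsilon> \<subseteq> H"
            using H(1) open_contains_cball by blast
          define h where "h = min \<epsilon> (x - u)"
          have h: "h > 0" "u \<le> x - h" "h \<le> \<epsilon>" using x \<epsilon> by (auto simp: h_def)
          have "{x-h..x} \<subseteq> H" using \<epsilon>(2) h by (auto simp: cball_def dist_real_def subset_iff)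
          then have "m x = m (x - h) + h" using m_eq[of "x-h" x] x h by auto
          moreover have "\<bar>f x - f (x - h)\<bar> \<le> K * h"
            using lipschitz_onD[OF lip, of x "x-h"] h by (simp add: dist_real_def)
          moreover have "q * h \<le> \<bar>q\<bar> * h" using h by (simp add: mult_right_mono)
          ultimately have "g (x - h) \<le> g x"
            by (simp add: g_def K'_def algebra_simps)
          then show ?thesis using h by (intro exI[of _ "x - h"]) auto
        qed
      qed
    qed
    moreover have "m u \<ge> 0" by (simp add: m_def)
    then have "K' * m u \<ge> 0" using K' by simp
    moreover have "m v \<le> measure lebesgue H"
      unfolding m_def using H by (intro measure_mono_fmeasurable) (auto simp: fmeasurableD Hm)
    then have "K' * m v \<le> K' * (measure lebesgue ({u..v} - E) + e)"
      using H K' by (intro mult_left_mono) auto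
    ultimately show ?thesis by (simp add: g_def algebra_simps)
  qed
  have "q * (v - u) - K' * measure lebesgue ({u..v} - E) - (f v - f u) \<le> 0"
  proof (rule field_le_epsilon)
    fix e :: real assume "e > 0"
    then have "K' * (e / (K' + 1)) \<le> e" using K' by (simp add: field_simps)
    then show "q * (v - u) - K' * measure lebesgue ({u..v} - E) - (f v - f u) \<le> 0 + e"
      using bound[of "e / (K' + 1)"] \<open>e > 0\<close> K' by (simp add: distrib_left)
  qed
  then show ?thesis by (simp add: K'_def)
qed

text \<open>At the points of this set, arbitrarily short difference quotients above \<open>q\<close>
  occur on side \<open>\<sigma>\<close> and below \<open>p\<close> on side \<open>\<sigma>'\<close>.
  The increment estimate for \<open>f\<close> and for \<open>- f\<close> therefore bounds the same
  increment from below with slope \<open>q\<close> and from above with slope \<open>p\<close>, up to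
  multiples of the measure of the complement. Hence the complement fills at least a fixed fraction
  of every interval. The two sides are chosen independently so that all four Dini derivates can be
  compared.\<close>

lemma negligible_upper_dini_gap:
  assumes lip: "K-lipschitz_on UNIV f" and "\<sigma> = 1 \<or> \<sigma> = -1" "\<sigma>' = 1 \<or> \<sigma>' = -1" and "p < q"
  shows "negligible (upper_dini_set f \<sigma> q \<inter> upper_dini_set (\<lambda>x. - f x) \<sigma>' (- p))"
proof (rule negligible_if_uniformly_sparse)
  let ?E = "upper_dini_set f \<sigma> q \<inter> upper_dini_set (\<lambda>x. - f x) \<sigma>' (- p)"
  have lip': "K-lipschitz_on UNIV (\<lambda>x. - f x)"
    using lip by (simp add: lipschitz_on_def dist_real_def abs_minus_commute)
  show E: "?E \<in> sets lebesgue"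
    using upper_dini_set_measurable lipschitz_on_continuous_on lip lip' by blast
  have "K \<ge> 0" using lip by (rule lipschitz_on_nonneg)
  define \<kappa> where "\<kappa> = (q - p) / (2 * K + \<bar>q\<bar> + \<bar>p\<bar> + 1)"
  show "0 < \<kappa>" using \<open>K \<ge> 0\<close> \<open>p < q\<close> by (simp add: \<kappa>_def)
  fix u v :: real assume "u \<le> v"
  define \<mu> where "\<mu> = measure lebesgue ({u..v} - ?E)"
  have "q * (v - u) - (K + \<bar>q\<bar>) * \<mu> \<le> f v - f u"
    unfolding \<mu>_def by (rule increment_ge_on_upper_dini_set[OF lip E _ assms(2) \<open>u \<le> v\<close>]) auto
  moreover have "- p * (v - u) - (K + \<bar>- p\<bar>) * \<mu> \<le> - f v - (- f u)"
    unfolding \<mu>_def by (rule increment_ge_on_upper_dini_set[OF lip' E _ assms(3) \<open>u \<le> v\<close>]) auto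
  moreover have "\<mu> \<ge> 0" by (simp add: \<mu>_def)
  ultimately have "(q - p) * (v - u) \<le> (2 * K + \<bar>q\<bar> + \<bar>p\<bar> + 1) * \<mu>"
    by (simp add: algebra_simps)
  then show "\<kappa> * (v - u) \<le> \<mu>"
    using \<open>K \<ge> 0\<close> unfolding \<kappa>_def by (simp add: field_simps)
qed

lemma not_in_upper_dini_setE:
  assumes "x \<notin> upper_dini_set f \<sigma> q"
  obtains d where "d > 0" "\<forall>h. 0 < h \<and> h < d \<longrightarrow> \<sigma> * (f (x + \<sigma> * h) - f x) \<le> q * h"
  using assms unfolding upper_dini_set_def mem_Collect_eq by (meson not_less)

text \<open>If the difference quotients at \<open>x\<close> had distinct upper and lower limits,
  rationals \<open>p < q\<close> between them would put \<open>x\<close> into one of the countably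
  many null sets \<open>G \<sigma> \<sigma>' p q\<close>.\<close>

lemma lipschitz_differentiable_AE_real:
  fixes f :: "real \<Rightarrow> real"
  assumes lip: "K-lipschitz_on UNIV f"
  shows "AE x in lebesgue. \<exists>D. (f has_real_derivative D) (at x)"
proof -
  define G where "G \<sigma> \<sigma>' p q = upper_dini_set f \<sigma> q \<inter> upper_dini_set (\<lambda>x. - f x) \<sigma>' (- p)" for \<sigma> \<sigma>' p q
  define I where "I = {(\<sigma>::real, \<sigma>'::real, p::real, q). \<sigma> \<in> {1, -1} \<and> \<sigma>' \<in> {1, -1} \<and> p \<in> \<rat> \<and> q \<in> \<rat> \<and> p < (q::real)}"
  define N where "N = (\<Union>(\<sigma>, \<sigma>', p, q)\<in>I. G \<sigma> \<sigma>' p q)"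
  have "I \<subseteq> {1, -1} \<times> {1, -1} \<times> \<rat> \<times> \<rat>" by (auto simp: I_def)
  then have "countable I"
    by (rule countable_subset) (intro countable_SIGMA countable_rat, auto)
  then have "negligible N"
    unfolding N_def G_def
    by (intro negligible_countable_Union) 
       (auto simp: I_def intro!: negligible_upper_dini_gap[OF lip])
  moreover have "\<exists>D. (f has_real_derivative D) (at x)" if x: "x \<notin> N" for x
  proof -
    define r where "r h = (f (x + h) - f x) / h" for h
    have le_if: "eventually (\<lambda>h. r h \<le> q) (at 0)"
      if nd: "x \<notin> upper_dini_set f 1 q" "x \<notin> upper_dini_set f (-1) q" for q
    proof -
      obtain d1 where d1: "d1 > 0" "\<forall>h. 0 < h \<and> h < d1 \<longrightarrow> 1 * (f (x + 1 * h) - f x) \<le> q * h"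
        using not_in_upper_dini_setE[OF nd(1)] by blast
      obtain d2 where d2: "d2 > 0" "\<forall>h. 0 < h \<and> h < d2 \<longrightarrow> -1 * (f (x + -1 * h) - f x) \<le> q * h"
        using not_in_upper_dini_setE[OF nd(2)] by blast
      have "r h \<le> q" if "h \<noteq> 0" "\<bar>h\<bar> < min d1 d2" for h
        using d1(2)[rule_format, of h] d2(2)[rule_format, of "-h"] that by (cases "h > 0") (auto simp: r_def field_simps)
      then show ?thesis
        unfolding eventually_at using d1(1) d2(1) by (intro exI[of _ "min d1 d2"]) (auto simp: dist_real_def)
    qed
    have ge_if: "eventually (\<lambda>h. p \<le> r h) (at 0)"
      if nd: "x \<notin> upper_dini_set (\<lambda>x. - f x) 1 (- p)" "x \<notin> upper_dini_set (\<lambda>x. - f x) (-1) (- p)" for p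
    proof -
      obtain d1 where d1: "d1 > 0" "\<forall>h. 0 < h \<and> h < d1 \<longrightarrow> 1 * (- f (x + 1 * h) - - f x) \<le> - p * h"
        using not_in_upper_dini_setE[OF nd(1)] by blast
      obtain d2 where d2: "d2 > 0" "\<forall>h. 0 < h \<and> h < d2 \<longrightarrow> -1 * (- f (x + -1 * h) - - f x) \<le> - p * h"
        using not_in_upper_dini_setE[OF nd(2)] by blast
      have "p \<le> r h" if "h \<noteq> 0" "\<bar>h\<bar> < min d1 d2" for h
        using d1(2)[rule_format, of h] d2(2)[rule_format, of "-h"] that by (cases "h > 0") (auto simp: r_def field_simps)
      then show ?thesis
        unfolding eventually_at using d1(1) d2(1) by (intro exI[of _ "min d1 d2"]) (auto simp: dist_real_def)
    qed
    have bd: "\<bar>r h\<bar> \<le> K" if "h \<noteq> 0" for h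
      using lipschitz_onD[OF lip, of "x+h" x] that by (simp add: r_def dist_real_def abs_divide field_simps)
    \<comment> \<open>\<open>Inf Q\<close> is the two-sided upper limit of the difference quotients;
      the Lipschitz bound makes \<open>Q\<close> nonempty and bounded below.\<close>
    define Q where "Q = {q. eventually (\<lambda>h. r h \<le> q) (at 0)}"
    have "K \<in> Q"
      unfolding Q_def mem_Collect_eq eventually_at using bd
      by (intro exI[of _ 1]) (auto dest: abs_le_D1)
    have bddQ: "bdd_below Q"
    proof (rule bdd_belowI)
      fix q assume "q \<in> Q"
      moreover have "eventually (\<lambda>h. h \<noteq> 0) (at (0::real))" by (auto simp: eventually_at intro!: exI[of _ 1])
      ultimately have "eventually (\<lambda>h. r h \<le> q \<and> h \<noteq> 0) (at 0)"
        unfolding Q_def by (auto intro: eventually_conj)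
      then obtain h where "r h \<le> q" "h \<noteq> 0" using eventually_happens[of _ "at (0::real)"] by auto
      then show "- K \<le> q" using bd[of h] by linarith
    qed
    have "(r \<longlongrightarrow> Inf Q) (at 0)"
    proof (rule order_tendstoI)
      fix b assume "Inf Q < b"
      then obtain q where "q \<in> Q" "q < b" using \<open>K \<in> Q\<close> by (metis cInf_lessD empty_iff)
      then show "eventually (\<lambda>h. r h < b) (at 0)"
        unfolding Q_def by (auto elim!: eventually_mono)
    next
      fix b assume "b < Inf Q"
      \<comment> \<open>Two rationals are inserted between \<open>b\<close> and
        \<open>Inf Q\<close>. The larger is no eventual upper bound, so \<open>x\<close> lies in an
        upper Dini set for \<open>q\<close> on some side; outside \<open>N\<close> this excludes
        quotients below \<open>p\<close> near \<open>x\<close> on both sides.\<close>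
      then obtain p where p: "p \<in> \<rat>" "b < p" "p < Inf Q" using Rats_dense_in_real by blast
      then obtain q where q: "q \<in> \<rat>" "p < q" "q < Inf Q" using Rats_dense_in_real by blast
      then have "q \<notin> Q" using bddQ cInf_lower by fastforce
      then obtain \<sigma> where "\<sigma> \<in> {1, -1}" "x \<in> upper_dini_set f \<sigma> q" using le_if unfolding Q_def by auto
      then have "x \<notin> upper_dini_set (\<lambda>x. - f x) \<sigma>' (- p)" if "\<sigma>' \<in> {1, -1}" for \<sigma>'
        using x p q that unfolding N_def G_def I_def by blast
      then have "eventually (\<lambda>h. p \<le> r h) (at 0)" using ge_if by simp
      then show "eventually (\<lambda>h. b < r h) (at 0)"
        using p by (auto elim!: eventually_mono)
    qed
    then show ?thesis
      unfolding DERIV_def r_def by blast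
  qed
  ultimately show ?thesis
    unfolding eventually_ae_filter_negligible by blast
qed

theorem lipschitz_differentiable_AE:
  fixes f :: "real \<Rightarrow> 'a::euclidean_space"
  assumes lip: "K-lipschitz_on UNIV f"
  shows "AE x in lebesgue. \<exists>D. (f has_vector_derivative D) (at x)"
proof -
  have "AE x in lebesgue. \<exists>D. ((\<lambda>t. f t \<bullet> b) has_real_derivative D) (at x)" if "b \<in> Basis" for b
  proof (rule lipschitz_differentiable_AE_real)
    show "K-lipschitz_on UNIV (\<lambda>t. f t \<bullet> b)"
    proof (rule lipschitz_onI)
      fix s t :: real
      have "\<bar>(f s - f t) \<bullet> b\<bar> \<le> norm (f s - f t)" using Basis_le_norm[OF that] .
      also have "\<dots> \<le> K * dist s t"
        using lipschitz_onD[OF lip] by (simp add: dist_norm)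
      finally show "dist (f s \<bullet> b) (f t \<bullet> b) \<le> K * dist s t"
        by (simp add: dist_real_def inner_diff_left)
    qed (use lip in \<open>rule lipschitz_on_nonneg\<close>)
  qed
  then have "AE x in lebesgue. \<forall>b\<in>Basis. \<exists>D. ((\<lambda>t. f t \<bullet> b) has_real_derivative D) (at x)"
    by (intro AE_finite_allI) auto
  then show ?thesis
  proof (rule eventually_mono)
    fix x assume "\<forall>b\<in>Basis. \<exists>D. ((\<lambda>t. f t \<bullet> b) has_real_derivative D) (at x)"
    then obtain D where D: "\<And>b. b \<in> Basis \<Longrightarrow> ((\<lambda>t. f t \<bullet> b) has_vector_derivative D b) (at x)"
      unfolding has_real_derivative_iff_has_vector_derivative by metis
    have "((\<lambda>t. \<Sum>b\<in>Basis. (f t \<bullet> b) *\<^sub>R b) has_vector_derivative (\<Sum>b\<in>Basis. D b *\<^sub>R b)) (at x)"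
      by (intro has_vector_derivative_sum)
         (auto intro!: derivative_eq_intros D simp: has_real_derivative_iff_has_vector_derivative)
    then show "\<exists>D. (f has_vector_derivative D) (at x)"
      by (auto simp: euclidean_representation)
  qed
qed

subsection \<open>Absolutely continuous functions\<close>

text \<open>Absolute continuity is defined with families numbered by \<open>nat\<close>, while a
  tagged division is a set of pairs; a bijection translates between the two.\<close>

lemma abs_continuous_on_finite_family:
  assumes "abs_continuous_on S f" "\<epsilon> > 0"
  obtains \<delta> where "\<delta> > 0"
    "\<forall>(P :: 'i set) u v. finite P \<longrightarrow> (\<forall>i\<in>P. u i \<le> v i \<and> {u i..v i} \<subseteq> S) \<longrightarrow>
       (\<forall>i\<in>P. \<forall>j\<in>P. i \<noteq> j \<longrightarrow> {u i<..<v i} \<inter> {u j<..<v j} = {}) \<longrightarrow>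
       (\<Sum>i\<in>P. v i - u i) < \<delta> \<longrightarrow> (\<Sum>i\<in>P. dist (f (u i)) (f (v i))) < \<epsilon>"
proof -
  obtain \<delta> where "\<delta> > 0" and \<delta>: "\<forall>N::nat. \<forall>u v :: nat \<Rightarrow> real.
        (\<forall>i<N. u i \<le> v i \<and> {u i..v i} \<subseteq> S) \<longrightarrow>
        (\<forall>i<N. \<forall>j<N. i \<noteq> j \<longrightarrow> {u i<..<v i} \<inter> {u j<..<v j} = {}) \<longrightarrow>
        (\<Sum>i<N. v i - u i) < \<delta> \<longrightarrow> (\<Sum>i<N. dist (f (u i)) (f (v i))) < \<epsilon>"
    using assms unfolding abs_continuous_on_def by blast
  show thesis
  proof (rule that[OF \<open>\<delta> > 0\<close>], intro allI impI)
    fix P :: "'i set" and u v :: "'i \<Rightarrow> real"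
    assume P: "finite P" and S: "\<forall>i\<in>P. u i \<le> v i \<and> {u i..v i} \<subseteq> S"
      and disj: "\<forall>i\<in>P. \<forall>j\<in>P. i \<noteq> j \<longrightarrow> {u i<..<v i} \<inter> {u j<..<v j} = {}"
      and sum: "(\<Sum>i\<in>P. v i - u i) < \<delta>"
    obtain h where h: "bij_betw h {..<card P} P"
      using ex_bij_betw_nat_finite[OF P] by (auto simp: atLeast0LessThan)
    have hP: "h i \<in> P" if "i < card P" for i using h that by (auto simp: bij_betw_def)
    have "(\<Sum>i<card P. dist (f (u (h i))) (f (v (h i)))) < \<epsilon>"
    proof (rule \<delta>[rule_format, of "card P" "\<lambda>i. u (h i)" "\<lambda>i. v (h i)"])
      show "(\<Sum>i<card P. v (h i) - u (h i)) < \<delta>"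
        using sum sum.reindex_bij_betw[OF h, of "\<lambda>i. v i - u i"] by simp
      show "{u (h i)<..<v (h i)} \<inter> {u (h j)<..<v (h j)} = {}" if "i < card P" "j < card P" "i \<noteq> j" for i j
      proof -
        have "h i \<noteq> h j"
          using h that unfolding bij_betw_def inj_on_def by blast
        then show ?thesis
          using disj hP that by blast
      qed
    qed (use hP S in auto)
    then show "(\<Sum>i\<in>P. dist (f (u i)) (f (v i))) < \<epsilon>"
      using sum.reindex_bij_betw[OF h, of "\<lambda>i. dist (f (u i)) (f (v i))"] by simp
  qed
qed

lemma negligible_Int_intervals:
  fixes a b c d :: real
  assumes "{a<..<b} \<inter> {c<..<d} = {}"
  shows "negligible ({a..b} \<inter> {c..d})"
proof -
  have "min b d \<le> max a c"
    using assms by (simp add: greaterThanLessThan_empty_iff)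
  then show ?thesis
    by (simp add: negligible_atLeastAtMostI)
qed

text \<open>A gauge argument. In a fine tagged division the intervals tagged outside the null set
  \<open>N\<close> contribute at most \<open>e\<close> times their length, by the derivative at the
  tag. Those tagged in \<open>N\<close> lie in an open set of measure below \<open>\<delta>\<close>,
  and absolute continuity bounds their total contribution by \<open>e\<close>.\<close>

lemma abs_continuous_nonincreasing:
  fixes g :: "real \<Rightarrow> real"
  assumes "a \<le> b" and ac: "abs_continuous_on {a..b} g"
    and AE: "AE t\<in>{a..b} in lebesgue. \<exists>D\<le>0. (g has_real_derivative D) (at t)"
  shows "g b \<le> g a"
proof -
  obtain N where N: "negligible N"
    "\<And>t. t \<in> {a..b} \<Longrightarrow> t \<notin> N \<Longrightarrow> \<exists>D\<le>0. (g has_real_derivative D) (at t)"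
    using AE unfolding eventually_ae_filter_negligible by blast
  have bound: "g b - g a \<le> e + e * (b - a)" if "e > 0" for e
  proof -
    obtain \<delta> where "\<delta> > 0" and \<delta>:
      "\<forall>(P :: (real \<times> real set) set) u v. finite P \<longrightarrow> (\<forall>i\<in>P. u i \<le> v i \<and> {u i..v i} \<subseteq> {a..b}) \<longrightarrow>
       (\<forall>i\<in>P. \<forall>j\<in>P. i \<noteq> j \<longrightarrow> {u i<..<v i} \<inter> {u j<..<v j} = {}) \<longrightarrow>
       (\<Sum>i\<in>P. v i - u i) < \<delta> \<longrightarrow> (\<Sum>i\<in>P. dist (g (u i)) (g (v i))) < e"
      by (rule abs_continuous_on_finite_family[OF ac \<open>e > 0\<close>, where 'i = "real \<times> real set"])
    obtain U where U: "open U" "N \<subseteq> U" "U \<in> lmeasurable" "measure lebesgue U < \<delta>"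
      using lmeasurable_outer_open[of N \<delta>] N(1) \<open>\<delta> > 0\<close>
      by (auto simp: negligible_iff_measure)
    \<comment> \<open>The straddle estimate: with \<open>x\<close> and \<open>y\<close> on opposite
      sides of the tag \<open>t\<close>, the two linear approximation errors add up to
      \<open>e * (y - x)\<close>, and the slope at \<open>t\<close> is nonpositive.\<close>
    have "\<exists>r>0. t \<in> {a..b} - N \<longrightarrow> (\<forall>x y. t - r < x \<and> x \<le> t \<and> t \<le> y \<and> y < t + r \<longrightarrow> g y - g x \<le> e * (y - x))" for t
    proof (cases "t \<in> {a..b} - N")
      case True
      then obtain D where D: "D \<le> 0" "(g has_real_derivative D) (at t)" using N(2) by blast
      then obtain r where r: "r > 0" "\<And>y. \<bar>y - t\<bar> < r \<Longrightarrow> \<bar>g y - g t - D * (y - t)\<bar> \<le> e * \<bar>y - t\<bar>"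
        using \<open>e > 0\<close> unfolding has_field_derivative_def has_derivative_at_alt by (auto simp: mult.commute)
      show ?thesis
      proof (intro exI[of _ r] conjI impI allI r(1))
        fix x y assume xy: "t - r < x \<and> x \<le> t \<and> t \<le> y \<and> y < t + r"
        have "D * (y - t) \<le> 0" "D * (x - t) \<ge> 0"
          using D(1) xy by (auto simp: mult_nonpos_nonneg mult_nonpos_nonpos)
        then show "g y - g x \<le> e * (y - x)"
          using r(2)[of x] r(2)[of y] xy by (simp add: algebra_simps)
      qed
    qed (auto intro: exI[of _ 1])
    then obtain r where r: "\<And>t. r t > 0" "\<And>t x y. t \<in> {a..b} - N \<Longrightarrow> t - r t < x \<Longrightarrow> x \<le> t \<Longrightarrow> t \<le> y \<Longrightarrow> y < t + r t \<Longrightarrow> g y - g x \<le> e * (y - x)"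
      by metis
    define \<gamma> where "\<gamma> t = (if t \<in> N then U else ball t (r t))" for t
    have "gauge \<gamma>" using U r by (auto simp: gauge_def \<gamma>_def)
    then obtain p where p: "p tagged_division_of {a..b}" "\<gamma> fine p"
      using fine_division_exists_real by blast
    define u v where "u = (\<lambda>i :: real \<times> real set. Inf (snd i))" and "v = (\<lambda>i :: real \<times> real set. Sup (snd i))"
    have fin: "finite p" using p(1) by (rule tagged_division_ofD(1))
    have K: "snd i = {u i..v i}" "u i \<le> fst i" "fst i \<le> v i" "snd i \<subseteq> {a..b}" "snd i \<subseteq> \<gamma> (fst i)"
      if ip: "i \<in> p" for i
    proof -
      have xK: "(fst i, snd i) \<in> p" using ip by simp
      obtain c d where "snd i = {c..d}" "fst i \<in> snd i"
        using tagged_division_ofD(2,4)[OF p(1) xK] by auto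
      then show "snd i = {u i..v i}" "u i \<le> fst i" "fst i \<le> v i"
        by (auto simp: u_def v_def)
      show "snd i \<subseteq> {a..b}" "snd i \<subseteq> \<gamma> (fst i)"
        using tagged_division_ofD(3)[OF p(1) xK] fineD[OF p(2) xK] by blast+
    qed
    have disj: "{u i<..<v i} \<inter> {u j<..<v j} = {}" if "i \<in> p" "j \<in> p" "i \<noteq> j" for i j
    proof -
      have "interior (snd i) \<inter> interior (snd j) = {}"
        using tagged_division_ofD(5)[OF p(1), of "fst i" "snd i" "fst j" "snd j"] that by auto
      moreover have "interior (snd i) = {u i<..<v i}" "interior (snd j) = {u j<..<v j}"
        using K(1) that by (metis interior_atLeastAtMost_real)+
      ultimately show ?thesis by simp
    qed
    define B where "B = {i \<in> p. fst i \<in> N}"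
    have "(\<Sum>i\<in>B. v i - u i) = (\<Sum>i\<in>B. measure lebesgue (snd i))"
    proof (rule sum.cong)
      fix i assume "i \<in> B"
      then have "snd i = {u i..v i}" "u i \<le> v i" using K[of i] by (auto simp: B_def)
      then show "v i - u i = measure lebesgue (snd i)" by simp
    qed simp
    also have "\<dots> = measure lebesgue (\<Union>i\<in>B. snd i)"
    proof (rule measure_negligible_finite_Union_image[symmetric])
      show "finite B" using fin by (simp add: B_def)
      show "snd i \<in> lmeasurable" if "i \<in> B" for i
        using K(1)[of i] that by (simp add: B_def)
      show "pairwise (\<lambda>x y. negligible (snd x \<inter> snd y)) B"
      proof (rule pairwiseI)
        fix i j assume ij: "i \<in> B" "j \<in> B" "i \<noteq> j"
        then have "snd i = {u i..v i}" "snd j = {u j..v j}"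
          using K(1) by (auto simp: B_def)
        then show "negligible (snd i \<inter> snd j)"
          using negligible_Int_intervals[OF disj[of i j]] ij by (auto simp: B_def)
      qed
    qed
    also have "\<dots> \<le> measure lebesgue U"
    proof (rule measure_mono_fmeasurable)
      show "(\<Union>i\<in>B. snd i) \<subseteq> U"
        using K(5) by (fastforce simp: B_def \<gamma>_def)
      show "(\<Union>i\<in>B. snd i) \<in> sets lebesgue"
        using fin K(1) by (intro sets.finite_UN) (auto simp: B_def)
    qed (rule U)
    finally have small: "(\<Sum>i\<in>B. v i - u i) < \<delta>" using U by simp
    have "(\<Sum>i\<in>B. dist (g (u i)) (g (v i))) < e"
    proof (rule \<delta>[rule_format, OF _ _ _ small])
      show "finite B" using fin by (simp add: B_def)
      show "u i \<le> v i \<and> {u i..v i} \<subseteq> {a..b}" if "i \<in> B" for i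
        using K[of i] that by (auto simp: B_def)
    qed (use disj in \<open>auto simp: B_def\<close>)
    moreover have "(\<Sum>i\<in>B. g (v i) - g (u i)) \<le> (\<Sum>i\<in>B. dist (g (u i)) (g (v i)))"
      by (intro sum_mono) (auto simp: dist_real_def)
    ultimately have bad: "(\<Sum>i\<in>B. g (v i) - g (u i)) \<le> e" by simp
    have "(\<Sum>i\<in>p - B. g (v i) - g (u i)) \<le> (\<Sum>i\<in>p - B. e * (v i - u i))"
    proof (rule sum_mono)
      fix i assume i: "i \<in> p - B"
      then have x: "fst i \<in> {a..b} - N" "i \<in> p" using K[of i] by (auto simp: B_def)
      moreover have "u i \<in> ball (fst i) (r (fst i))" "v i \<in> ball (fst i) (r (fst i))"
        using K[OF x(2)] x unfolding \<gamma>_def by (auto simp: subset_iff)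
      ultimately show "g (v i) - g (u i) \<le> e * (v i - u i)"
        using r(2)[OF x(1), of "u i" "v i"] K[OF x(2)] by (auto simp: dist_real_def)
    qed
    also have "\<dots> \<le> (\<Sum>i\<in>p. e * (v i - u i))"
    proof (rule sum_mono2[OF fin])
      show "0 \<le> e * (v i - u i)" if "i \<in> p - (p - B)" for i
        using K(2,3)[of i] that \<open>e > 0\<close> by (auto intro!: mult_nonneg_nonneg)
    qed blast
    also have "\<dots> = e * (b - a)"
      using additive_tagged_division_1[OF \<open>a \<le> b\<close> p(1), of "\<lambda>x. x"]
      by (simp add: sum_distrib_left[symmetric] u_def v_def case_prod_beta)
    finally have good: "(\<Sum>i\<in>p - B. g (v i) - g (u i)) \<le> e * (b - a)" .
    have "g b - g a = (\<Sum>i\<in>p. g (v i) - g (u i))"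
      using additive_tagged_division_1[OF \<open>a \<le> b\<close> p(1), of g]
      by (simp add: u_def v_def case_prod_beta)
    also have "\<dots> = (\<Sum>i\<in>p - B. g (v i) - g (u i)) + (\<Sum>i\<in>B. g (v i) - g (u i))"
      using fin by (intro sum.subset_diff) (auto simp: B_def)
    finally show ?thesis using good bad by simp
  qed
  have "g b - g a \<le> 0"
  proof (rule field_le_epsilon)
    fix e :: real assume "e > 0"
    have "e / (1 + (b - a)) + e / (1 + (b - a)) * (b - a) = e / (1 + (b - a)) * (1 + (b - a))"
      by (simp add: distrib_left)
    then show "g b - g a \<le> 0 + e"
      using bound[of "e / (1 + (b - a))"] \<open>a \<le> b\<close> \<open>e > 0\<close> by simp
  qed
  then show ?thesis by simp
qed

lemma lipschitz_imp_abs_continuous_on: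
  assumes "L-lipschitz_on S f"
  shows "abs_continuous_on S f"
  unfolding abs_continuous_on_def
proof (intro allI impI)
  fix \<epsilon> :: real assume "\<epsilon> > 0"
  have L: "L \<ge> 0" using assms by (rule lipschitz_on_nonneg)
  show "\<exists>\<delta>>0. \<forall>N::nat. \<forall>u v :: nat \<Rightarrow> real. (\<forall>i<N. u i \<le> v i \<and> {u i..v i} \<subseteq> S) \<longrightarrow>
        (\<forall>i<N. \<forall>j<N. i \<noteq> j \<longrightarrow> {u i<..<v i} \<inter> {u j<..<v j} = {}) \<longrightarrow>
        (\<Sum>i<N. v i - u i) < \<delta> \<longrightarrow> (\<Sum>i<N. dist (f (u i)) (f (v i))) < \<epsilon>"
  proof (intro exI[of _ "\<epsilon> / (L + 1)"] conjI allI impI)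
    show "0 < \<epsilon> / (L + 1)" using \<open>\<epsilon> > 0\<close> L by simp
    fix N :: nat and u v :: "nat \<Rightarrow> real"
    assume S: "\<forall>i<N. u i \<le> v i \<and> {u i..v i} \<subseteq> S" and sum: "(\<Sum>i<N. v i - u i) < \<epsilon> / (L + 1)"
    have "(\<Sum>i<N. dist (f (u i)) (f (v i))) \<le> (\<Sum>i<N. (L + 1) * (v i - u i))"
    proof (rule sum_mono)
      fix i assume "i \<in> {..<N}"
      then have i: "u i \<le> v i" "{u i..v i} \<subseteq> S" using S by auto
      then have "u i \<in> S" "v i \<in> S" by auto
      then have "dist (f (u i)) (f (v i)) \<le> L * (v i - u i)"
        using lipschitz_onD[OF assms, of "u i" "v i"] i(1) by (simp add: dist_real_def)
      then show "dist (f (u i)) (f (v i)) \<le> (L + 1) * (v i - u i)"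
        using i(1) by (simp add: distrib_right)
    qed
    also have "\<dots> < \<epsilon>"
      using mult_strict_left_mono[OF sum, of "L + 1"] L by (simp add: sum_distrib_left)
    finally show "(\<Sum>i<N. dist (f (u i)) (f (v i))) < \<epsilon>" .
  qed
qed

text \<open>A bound on increments covers all later combinations at once: linear images of
  differences, norms, and the sum of a norm and a linear function of time.\<close>

lemma abs_continuous_on_dominated:
  assumes f: "abs_continuous_on S f" and g: "abs_continuous_on S g" and "M > 0"
    and dom: "\<And>s t. s \<in> S \<Longrightarrow> t \<in> S \<Longrightarrow> dist (h s) (h t) \<le> M * (dist (f s) (f t) + dist (g s) (g t))"
  shows "abs_continuous_on S h"
  unfolding abs_continuous_on_def
proof (intro allI impI)
  fix \<epsilon> :: real assume "\<epsilon> > 0"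
  then have \<epsilon>': "\<epsilon> / (2 * M) > 0" using \<open>M > 0\<close> by simp
  obtain \<delta>1 where f1: "\<delta>1 > 0" "\<forall>N::nat. \<forall>u v :: nat \<Rightarrow> real. (\<forall>i<N. u i \<le> v i \<and> {u i..v i} \<subseteq> S) \<longrightarrow>
        (\<forall>i<N. \<forall>j<N. i \<noteq> j \<longrightarrow> {u i<..<v i} \<inter> {u j<..<v j} = {}) \<longrightarrow>
        (\<Sum>i<N. v i - u i) < \<delta>1 \<longrightarrow> (\<Sum>i<N. dist (f (u i)) (f (v i))) < \<epsilon> / (2 * M)"
    using f \<epsilon>' unfolding abs_continuous_on_def by blast
  obtain \<delta>2 where g1: "\<delta>2 > 0" "\<forall>N::nat. \<forall>u v :: nat \<Rightarrow> real. (\<forall>i<N. u i \<le> v i \<and> {u i..v i} \<subseteq> S) \<longrightarrow>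
        (\<forall>i<N. \<forall>j<N. i \<noteq> j \<longrightarrow> {u i<..<v i} \<inter> {u j<..<v j} = {}) \<longrightarrow>
        (\<Sum>i<N. v i - u i) < \<delta>2 \<longrightarrow> (\<Sum>i<N. dist (g (u i)) (g (v i))) < \<epsilon> / (2 * M)"
    using g \<epsilon>' unfolding abs_continuous_on_def by blast
  show "\<exists>\<delta>>0. \<forall>N::nat. \<forall>u v :: nat \<Rightarrow> real. (\<forall>i<N. u i \<le> v i \<and> {u i..v i} \<subseteq> S) \<longrightarrow>
        (\<forall>i<N. \<forall>j<N. i \<noteq> j \<longrightarrow> {u i<..<v i} \<inter> {u j<..<v j} = {}) \<longrightarrow>
        (\<Sum>i<N. v i - u i) < \<delta> \<longrightarrow> (\<Sum>i<N. dist (h (u i)) (h (v i))) < \<epsilon>"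
  proof (intro exI[of _ "min \<delta>1 \<delta>2"] conjI allI impI)
    fix N :: nat and u v :: "nat \<Rightarrow> real"
    assume S: "\<forall>i<N. u i \<le> v i \<and> {u i..v i} \<subseteq> S"
      and dj: "\<forall>i<N. \<forall>j<N. i \<noteq> j \<longrightarrow> {u i<..<v i} \<inter> {u j<..<v j} = {}"
      and sum: "(\<Sum>i<N. v i - u i) < min \<delta>1 \<delta>2"
    have "(\<Sum>i<N. dist (f (u i)) (f (v i))) < \<epsilon> / (2 * M)"
      using f1(2)[rule_format, of N u v] S dj sum by simp
    moreover have "(\<Sum>i<N. dist (g (u i)) (g (v i))) < \<epsilon> / (2 * M)"
      using g1(2)[rule_format, of N u v] S dj sum by simp
    ultimately have "M * ((\<Sum>i<N. dist (f (u i)) (f (v i))) + (\<Sum>i<N. dist (g (u i)) (g (v i)))) < M * (\<epsilon> / (2 * M) + \<epsilon> / (2 * M))"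
      using \<open>M > 0\<close> by (intro mult_strict_left_mono add_strict_mono)
    also have "\<dots> = \<epsilon>" using \<open>M > 0\<close> by (simp add: field_simps)
    finally have "(\<Sum>i<N. M * (dist (f (u i)) (f (v i)) + dist (g (u i)) (g (v i)))) < \<epsilon>"
      by (simp add: sum.distrib sum_distrib_left distrib_left)
    moreover have "(\<Sum>i<N. dist (h (u i)) (h (v i))) \<le> (\<Sum>i<N. M * (dist (f (u i)) (f (v i)) + dist (g (u i)) (g (v i))))"
    proof (rule sum_mono)
      fix i assume "i \<in> {..<N}"
      then have i: "u i \<le> v i" "{u i..v i} \<subseteq> S" using S by auto
      then have "u i \<in> S" "v i \<in> S" by auto
      then show "dist (h (u i)) (h (v i)) \<le> M * (dist (f (u i)) (f (v i)) + dist (g (u i)) (g (v i)))"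
        by (rule dom)
    qed
    ultimately show "(\<Sum>i<N. dist (h (u i)) (h (v i))) < \<epsilon>" by linarith
  qed (use f1(1) g1(1) in simp)
qed

lemma abs_continuous_on_subset:
  assumes "abs_continuous_on S f" "S' \<subseteq> S"
  shows "abs_continuous_on S' f"
  unfolding abs_continuous_on_def
proof (intro allI impI)
  fix \<epsilon> :: real assume "\<epsilon> > 0"
  obtain \<delta> where "\<delta> > 0" and \<delta>: "\<forall>N::nat. \<forall>u v :: nat \<Rightarrow> real.
        (\<forall>i<N. u i \<le> v i \<and> {u i..v i} \<subseteq> S) \<longrightarrow>
        (\<forall>i<N. \<forall>j<N. i \<noteq> j \<longrightarrow> {u i<..<v i} \<inter> {u j<..<v j} = {}) \<longrightarrow>
        (\<Sum>i<N. v i - u i) < \<delta> \<longrightarrow> (\<Sum>i<N. dist (f (u i)) (f (v i))) < \<epsilon>"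
    using assms(1)[unfolded abs_continuous_on_def, THEN spec, THEN mp, OF \<open>\<epsilon> > 0\<close>] by blast
  show "\<exists>\<delta>>0. \<forall>N::nat. \<forall>u v :: nat \<Rightarrow> real. (\<forall>i<N. u i \<le> v i \<and> {u i..v i} \<subseteq> S') \<longrightarrow>
        (\<forall>i<N. \<forall>j<N. i \<noteq> j \<longrightarrow> {u i<..<v i} \<inter> {u j<..<v j} = {}) \<longrightarrow>
        (\<Sum>i<N. v i - u i) < \<delta> \<longrightarrow> (\<Sum>i<N. dist (f (u i)) (f (v i))) < \<epsilon>"
  proof (intro exI[of _ \<delta>] conjI allI impI \<open>\<delta> > 0\<close>)
    fix N :: nat and u v :: "nat \<Rightarrow> real"
    assume S': "\<forall>i<N. u i \<le> v i \<and> {u i..v i} \<subseteq> S'"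
      and dj: "\<forall>i<N. \<forall>j<N. i \<noteq> j \<longrightarrow> {u i<..<v i} \<inter> {u j<..<v j} = {}"
      and sum: "(\<Sum>i<N. v i - u i) < \<delta>"
    show "(\<Sum>i<N. dist (f (u i)) (f (v i))) < \<epsilon>"
    proof (rule \<delta>[rule_format, of N u v])
      show "u i \<le> v i \<and> {u i..v i} \<subseteq> S" if "i < N" for i
        using S' that \<open>S' \<subseteq> S\<close> by (meson subset_trans)
      show "{u i<..<v i} \<inter> {u j<..<v j} = {}" if "i < N" "j < N" "i \<noteq> j" for i j
        using dj that by blast
    qed (rule sum)
  qed
qed

lemma abs_continuous_on_id: "abs_continuous_on S (\<lambda>t::real. t)"
  by (rule lipschitz_imp_abs_continuous_on[of 1]) (rule lipschitz_on_id)

lemma abs_continuous_on_shift: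
  assumes "abs_continuous_on {a + T..b + T} f"
  shows "abs_continuous_on {a..b} (\<lambda>t. f (t + T))"
  unfolding abs_continuous_on_def
proof (intro allI impI)
  fix \<epsilon> :: real assume "\<epsilon> > 0"
  obtain \<delta> where "\<delta> > 0" and \<delta>: "\<forall>N::nat. \<forall>u v :: nat \<Rightarrow> real.
        (\<forall>i<N. u i \<le> v i \<and> {u i..v i} \<subseteq> {a + T..b + T}) \<longrightarrow>
        (\<forall>i<N. \<forall>j<N. i \<noteq> j \<longrightarrow> {u i<..<v i} \<inter> {u j<..<v j} = {}) \<longrightarrow>
        (\<Sum>i<N. v i - u i) < \<delta> \<longrightarrow> (\<Sum>i<N. dist (f (u i)) (f (v i))) < \<epsilon>"
    using assms(1)[unfolded abs_continuous_on_def, THEN spec, THEN mp, OF \<open>\<epsilon> > 0\<close>] by blast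
  show "\<exists>\<delta>>0. \<forall>N::nat. \<forall>u v :: nat \<Rightarrow> real. (\<forall>i<N. u i \<le> v i \<and> {u i..v i} \<subseteq> {a..b}) \<longrightarrow>
        (\<forall>i<N. \<forall>j<N. i \<noteq> j \<longrightarrow> {u i<..<v i} \<inter> {u j<..<v j} = {}) \<longrightarrow>
        (\<Sum>i<N. v i - u i) < \<delta> \<longrightarrow> (\<Sum>i<N. dist (f (u i + T)) (f (v i + T))) < \<epsilon>"
  proof (intro exI[of _ \<delta>] conjI allI impI \<open>\<delta> > 0\<close>)
    fix N :: nat and u v :: "nat \<Rightarrow> real"
    assume S: "\<forall>i<N. u i \<le> v i \<and> {u i..v i} \<subseteq> {a..b}"
      and dj: "\<forall>i<N. \<forall>j<N. i \<noteq> j \<longrightarrow> {u i<..<v i} \<inter> {u j<..<v j} = {}"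
      and sum: "(\<Sum>i<N. v i - u i) < \<delta>"
    show "(\<Sum>i<N. dist (f (u i + T)) (f (v i + T))) < \<epsilon>"
    proof (rule \<delta>[rule_format, of N "\<lambda>i. u i + T" "\<lambda>i. v i + T"])
      show "{u i + T<..<v i + T} \<inter> {u j + T<..<v j + T} = {}" if "i < N" "j < N" "i \<noteq> j" for i j
      proof -
        have "{u i<..<v i} \<inter> {u j<..<v j} = {}" using dj that by blast
        then show ?thesis by (auto simp: greaterThanLessThan_empty_iff min_def max_def split: if_splits)
      qed
      show "u i + T \<le> v i + T \<and> {u i + T..v i + T} \<subseteq> {a + T..b + T}" if "i < N" for i
        using S that by fastforce
    qed (use sum in simp)
  qed
qed

subsection \<open>Existence of solutions\<close>

text \<open>The quadratic term bounds the variation of \<open>c\<close> and \<open>y\<close> over \<open>[s, t]\<close>, which makes the inequality exact on finite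
  sets of times and closed under pointwise limits.\<close>

definition catch_up_on ::
  "('a::real_inner) set \<Rightarrow> (real \<Rightarrow> 'a) \<Rightarrow> real \<Rightarrow> real set \<Rightarrow> (real \<Rightarrow> 'a) \<Rightarrow> bool" where
  "catch_up_on K c L I y \<longleftrightarrow>
     (\<forall>t\<in>I. y t - c t \<in> K) \<and>
     (\<forall>s\<in>I. \<forall>t\<in>I. s \<le> t \<longrightarrow> norm (y t - y s) \<le> L * (t - s) \<and>
        (\<forall>\<xi>\<in>K. - 2 * L\<^sup>2 * (t - s)\<^sup>2 \<le> (y t - y s) \<bullet> (\<xi> + c s - y s)))"

text \<open>One catching-up step: the last position \<open>y p\<close> is projected onto the moved
  set \<open>K + c b\<close>. The projection inequality holds relative to the new position;
  rewriting it relative to an earlier time \<open>s\<close> costs at most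
  \<open>2 * L\<^sup>2 * (b - p) * (b - s)\<close>.\<close>

lemma catch_up_on_extend:
  fixes K :: "'a::euclidean_space set"
  assumes K: "closed K" "convex K" and lip: "L-lipschitz_on I' c"
    and y: "catch_up_on K c L I y" and p: "p \<in> I" "\<And>s. s \<in> I \<Longrightarrow> s \<le> p" "p < b"
    and I': "insert b I \<subseteq> I'"
  shows "catch_up_on K c L (insert b I) (y(b := c b + closest_point K (y p - c b)))"
proof -
  define yb where "yb = c b + closest_point K (y p - c b)"
  have L: "L \<ge> 0" using lip by (rule lipschitz_on_nonneg)
  have lipc: "norm (c s - c t) \<le> L * \<bar>s - t\<bar>" if "s \<in> insert b I" "t \<in> insert b I" for s t
    using lipschitz_onD[OF lip, of s t] that I' by (auto simp: dist_norm)
  have bI: "b \<notin> I" using p(2,3) by force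
  have yI: "y t - c t \<in> K" if "t \<in> I" for t using y that by (simp add: catch_up_on_def)
  have yL: "norm (y t - y s) \<le> L * (t - s)" if "s \<in> I" "t \<in> I" "s \<le> t" for s t
    using y that by (simp add: catch_up_on_def)
  have yV: "- 2 * L\<^sup>2 * (t - s)\<^sup>2 \<le> (y t - y s) \<bullet> (\<xi> + c s - y s)" if "s \<in> I" "t \<in> I" "s \<le> t" "\<xi> \<in> K" for s t \<xi>
    using y that by (simp add: catch_up_on_def)
  have ybK: "yb - c b \<in> K"
    using closest_point_in_set[OF K(1)] yI[OF p(1)] by (auto simp: yb_def)
  \<comment> \<open>The point \<open>y p - c p\<close> already lies in \<open>K\<close>, so
    projecting \<open>y p - c b\<close> moves it no farther than \<open>c\<close> has moved.\<close>
  have step: "norm (yb - y p) \<le> L * (b - p)"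
  proof -
    have "norm (yb - y p) = dist (y p - c b) (closest_point K (y p - c b))"
      by (simp add: yb_def dist_norm norm_minus_commute algebra_simps)
    also have "\<dots> \<le> dist (y p - c b) (y p - c p)"
      by (rule closest_point_le[OF K(1) yI[OF p(1)]])
    also have "\<dots> \<le> L * (b - p)"
      using lipc[of p b] p by (simp add: dist_norm abs_if norm_minus_commute algebra_simps)
    finally show ?thesis .
  qed
  have dist_b: "norm (yb - y s) \<le> L * (b - s)" if "s \<in> I" for s
  proof -
    have "norm (yb - y s) \<le> norm (yb - y p) + norm (y p - y s)"
      using norm_triangle_ineq[of "yb - y p" "y p - y s"] by simp
    also have "\<dots> \<le> L * (b - p) + L * (p - s)"
      using step yL[OF that p(1) p(2)[OF that]] by simp
    finally show ?thesis by (simp add: algebra_simps)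
  qed
  have var_b: "- 2 * L\<^sup>2 * (b - s)\<^sup>2 \<le> (yb - y s) \<bullet> (\<xi> + c s - y s)" if s: "s \<in> I" and \<xi>: "\<xi> \<in> K" for s \<xi>
  proof -
    have sp: "s \<le> p" using p(2)[OF s] .
    have "(y p - c b - closest_point K (y p - c b)) \<bullet> (\<xi> - closest_point K (y p - c b)) \<le> 0"
      by (rule closest_point_dot[OF K(2,1) \<xi>])
    then have "(yb - y p) \<bullet> (\<xi> + c b - yb) \<ge> 0"
      by (simp add: yb_def algebra_simps inner_diff_left inner_add_left)
    moreover have "\<bar>(yb - y p) \<bullet> ((c s - c b) + (yb - y s))\<bar> \<le> L * (b - p) * (2 * L * (b - s))"
    proof -
      have "norm ((c s - c b) + (yb - y s)) \<le> norm (c s - c b) + norm (yb - y s)"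
        by (rule norm_triangle_ineq)
      also have "\<dots> \<le> L * (b - s) + L * (b - s)"
        using lipc[of s b] dist_b[OF s] s sp p(3) by (simp add: abs_if)
      finally have "norm ((c s - c b) + (yb - y s)) \<le> 2 * L * (b - s)" by simp
      then have "norm (yb - y p) * norm ((c s - c b) + (yb - y s)) \<le> L * (b - p) * (2 * L * (b - s))"
        using step L p(3) by (intro mult_mono) auto
      then show ?thesis using Cauchy_Schwarz_ineq2 order_trans by blast
    qed
    moreover have "(yb - y p) \<bullet> (\<xi> + c s - y s) = (yb - y p) \<bullet> (\<xi> + c b - yb) + (yb - y p) \<bullet> ((c s - c b) + (yb - y s))"
      by (simp add: inner_add_right[symmetric] add_diff_eq)
    ultimately have "- (L * (b - p) * (2 * L * (b - s))) \<le> (yb - y p) \<bullet> (\<xi> + c s - y s)"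
      by linarith
    moreover have "- 2 * L\<^sup>2 * (p - s)\<^sup>2 \<le> (y p - y s) \<bullet> (\<xi> + c s - y s)"
      by (rule yV[OF s p(1) sp \<xi>])
    \<comment> \<open>This is why the quadratic error does not accumulate over the steps: the new
      cost and the old error for \<open>[s, p]\<close> together fit into the error allowed for
      \<open>[s, b]\<close>, with the same constant.\<close>
    moreover have "L\<^sup>2 * ((b - p) * (b - s) + (p - s)\<^sup>2) \<le> L\<^sup>2 * (b - s)\<^sup>2"
    proof (rule mult_left_mono)
      have "(p - s) * (p - s) \<le> (p - s) * (b - s)"
        using sp p(3) by (intro mult_left_mono) auto
      then show "(b - p) * (b - s) + (p - s)\<^sup>2 \<le> (b - s)\<^sup>2"
        by (simp add: power2_eq_square algebra_simps)
    qed simp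
    moreover have "(yb - y s) \<bullet> (\<xi> + c s - y s) = (yb - y p) \<bullet> (\<xi> + c s - y s) + (y p - y s) \<bullet> (\<xi> + c s - y s)"
      by (simp add: inner_diff_left)
    ultimately show ?thesis by (simp add: power2_eq_square algebra_simps)
  qed
  show ?thesis
    unfolding catch_up_on_def yb_def[symmetric]
    using bI yI yL yV ybK dist_b var_b p(2,3)
    by (auto dest: p(2))
qed

lemma catch_up_on_finite:
  fixes K :: "'a::euclidean_space set"
  assumes K: "closed K" "convex K" and lip: "L-lipschitz_on {a..} c" and x0: "x0 \<in> K"
    and "finite I" "I \<subseteq> {a<..}"
  shows "\<exists>y. y a = x0 + c a \<and> catch_up_on K c L (insert a I) y"
  using \<open>finite I\<close> \<open>I \<subseteq> {a<..}\<close>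
proof (induction I rule: finite_linorder_max_induct)
  case empty
  have "catch_up_on K c L {a} (\<lambda>_. x0 + c a)" using x0 by (simp add: catch_up_on_def)
  then show ?case by auto
next
  case (insert b I)
  then obtain y where y: "y a = x0 + c a" "catch_up_on K c L (insert a I) y" by auto
  define p where "p = Max (insert a I)"
  have p: "p \<in> insert a I" "\<And>s. s \<in> insert a I \<Longrightarrow> s \<le> p"
    unfolding p_def using insert Max_in[of "insert a I"] Max_ge[of "insert a I"] by blast+
  have "p < b" using p(1) insert by auto
  have "insert b (insert a I) \<subseteq> {a..}" using insert.prems by auto
  then have "catch_up_on K c L (insert b (insert a I)) (y(b := c b + closest_point K (y p - c b)))"
    using catch_up_on_extend[OF K lip y(2) p \<open>p < b\<close>] by blast
  moreover have "a \<noteq> b" using insert.prems by auto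
  ultimately show ?case
    using y(1) by (intro exI[of _ "y(b := c b + closest_point K (y p - c b))"]) (simp add: insert_commute del: fun_upd_apply, simp)
qed

text \<open>Each condition in \<open>\<Phi> (s, t)\<close> involves only the values at
  \<open>a\<close>, \<open>s\<close> and \<open>t\<close>, hence is closed for pointwise
  convergence. Finitely many pairs are satisfied simultaneously by a discrete scheme through their
  times, so compactness of \<open>X\<close> yields one function for all pairs.\<close>

lemma catch_up_limit_exists:
  fixes K :: "'a::euclidean_space set"
  assumes K: "closed K" "convex K" and lip: "L-lipschitz_on {a..} c" and x0: "x0 \<in> K"
  obtains z where "z a = x0 + c a" "catch_up_on K c L {a..} z"
proof -
  have L: "L \<ge> 0" using lip by (rule lipschitz_on_nonneg)
  define z0 where "z0 = x0 + c a"
  \<comment> \<open>The radius is the a priori Lipschitz bound. Before time \<open>a\<close> it is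
    0, which pins the function there to \<open>z0\<close>.\<close>
  define X where "X = PiE UNIV (\<lambda>t. cball z0 (L * max 0 (t - a)))"
  have "compactin (product_topology (\<lambda>_. euclidean) UNIV) X"
    unfolding X_def compactin_PiE by auto
  then have X: "compact X" by (simp add: euclidean_product_topology)
  define \<Phi> where "\<Phi> = (\<lambda>(s, t). {y :: real \<Rightarrow> 'a. y a = z0 \<and> y s - c s \<in> K \<and> norm (y t - y s) \<le> L * (t - s) \<and>
     (\<forall>\<xi>\<in>K. - 2 * L\<^sup>2 * (t - s)\<^sup>2 \<le> (y t - y s) \<bullet> (\<xi> + c s - y s))})"
  define J where "J = {(s, t). a \<le> s \<and> s \<le> t}"
  have "X \<inter> (\<Inter>i\<in>J. \<Phi> i) \<noteq> {}"
  proof (rule compact_imp_fip_image[OF X])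
    fix i assume "i \<in> J"
    obtain s t where i: "i = (s, t)" by (cases i)
    have "closed {y :: real \<Rightarrow> 'a. y a = z0}" "closed {y :: real \<Rightarrow> 'a. norm (y t - y s) \<le> L * (t - s)}"
      "closed {y :: real \<Rightarrow> 'a. - 2 * L\<^sup>2 * (t - s)\<^sup>2 \<le> (y t - y s) \<bullet> (\<xi> + c s - y s)}" for \<xi>
      by (intro closed_Collect_eq closed_Collect_le continuous_intros continuous_on_product_coordinates)+
    moreover have "closed ((\<lambda>y :: real \<Rightarrow> 'a. y s - c s) -` K)"
      by (intro closed_vimage K(1) continuous_intros continuous_on_product_coordinates)
    ultimately show "closed (\<Phi> i)"
      unfolding \<Phi>_def i vimage_def case_prod_conv
      by (intro closed_Collect_conj) (auto simp: Collect_ball_eq intro!: closed_INT)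
  next
    fix I' assume I': "finite I'" "I' \<subseteq> J"
    define F where "F = (fst ` I' \<union> snd ` I') - {a}"
    have F: "finite F" "F \<subseteq> {a<..}" using I' by (auto simp: F_def J_def)
    obtain y where y: "y a = z0" "catch_up_on K c L (insert a F) y"
      using catch_up_on_finite[OF K lip x0 F] unfolding z0_def by blast
    \<comment> \<open>Away from the chosen times any value inside the ball of \<open>X\<close> will
      do; its centre is taken.\<close>
    define y' where "y' t = (if t \<in> insert a F then y t else z0)" for t
    have y': "y' a = z0" "catch_up_on K c L (insert a F) y'"
      using y by (auto simp: y'_def catch_up_on_def)
    have "y' \<in> X"
      unfolding X_def
    proof (intro PiE_I)
      fix t :: real
      show "y' t \<in> cball z0 (L * max 0 (t - a))"
      proof (cases "t \<in> insert a F")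
        case True
        then have "norm (y' t - y' a) \<le> L * (t - a)" "t \<ge> a"
          using y'(2) F(2) by (auto simp: catch_up_on_def)
        then show ?thesis using y'(1) by (simp add: dist_norm norm_minus_commute max_def)
      qed (use L in \<open>simp add: y'_def\<close>)
    qed simp
    moreover have "y' \<in> \<Phi> i" if "i \<in> I'" for i
    proof -
      obtain s t where i: "i = (s, t)" by (cases i)
      have "s \<in> insert a F" "t \<in> insert a F" "s \<le> t"
        using that I'(2) i by (force simp: F_def J_def)+
      then show ?thesis
        using y' unfolding i \<Phi>_def catch_up_on_def by auto
    qed
    ultimately show "X \<inter> (\<Inter>i\<in>I'. \<Phi> i) \<noteq> {}" by blast
  qed
  then obtain z where z: "\<And>s t. a \<le> s \<Longrightarrow> s \<le> t \<Longrightarrow> z \<in> \<Phi> (s, t)"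
    unfolding J_def by blast
  show thesis
  proof (rule that[of z])
    show "z a = x0 + c a" using z[of a a] by (simp add: \<Phi>_def z0_def)
    show "catch_up_on K c L {a..} z" using z unfolding \<Phi>_def catch_up_on_def by auto
  qed
qed

text \<open>Divided by \<open>h\<close>, the quadratic defect tends to 0. This is how a variational
  inequality for finite increments becomes one for the derivative.\<close>

lemma has_real_derivative_nonneg:
  assumes g: "(g has_real_derivative d) (at t)" and inc: "\<And>h. h > 0 \<Longrightarrow> - M * h\<^sup>2 \<le> g (t + h) - g t"
  shows "0 \<le> d"
proof -
  have "((\<lambda>h. (g (t + h) - g t) / h) \<longlongrightarrow> d) (at_right 0)"
    using g unfolding DERIV_def by (rule tendsto_mono[rotated]) (simp add: at_le)
  moreover have "((\<lambda>h. - M * h) \<longlongrightarrow> - M * 0) (at_right (0::real))"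
    by (intro tendsto_intros)
  moreover have "eventually (\<lambda>h. - M * h \<le> (g (t + h) - g t) / h) (at_right 0)"
    using eventually_at_right_less[of "0::real"]
  proof (rule eventually_mono)
    fix h :: real assume "0 < h"
    then show "- M * h \<le> (g (t + h) - g t) / h"
      using inc[of h] by (simp add: field_simps power2_eq_square)
  qed
  ultimately have "- M * 0 \<le> d"
    by (intro tendsto_le[of "at_right (0::real)"]) auto
  then show ?thesis by simp
qed

text \<open>For \<open>x\<close> orthogonal to \<open>V\<close> the scalar product with
  \<open>f\<close> vanishes from time \<open>t\<close> on, so the preceding lemma with
  \<open>M = 0\<close> applies to both \<open>x\<close> and \<open>- x\<close>. Thus
  \<open>D\<close> lies in the double orthogonal complement of \<open>V\<close>.\<close>

lemma vector_derivative_in_subspace: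
  fixes f :: "real \<Rightarrow> 'a::euclidean_space"
  assumes f: "(f has_vector_derivative D) (at t)" and V: "subspace V" "\<And>s. s \<ge> t \<Longrightarrow> f s \<in> V"
  shows "D \<in> V"
proof -
  have "orthogonal x D" if x: "x \<in> V\<^sup>\<bottom>" for x
  proof -
    have d: "((\<lambda>s. f s \<bullet> b) has_real_derivative D \<bullet> b) (at t)" for b
      using bounded_linear.has_vector_derivative[OF bounded_linear_inner_left f]
      by (simp add: has_real_derivative_iff_has_vector_derivative)
    have "f s \<bullet> x = 0" if "s \<ge> t" for s
      using x V(2)[OF that] by (auto simp: orthogonal_comp_def orthogonal_def inner_commute)
    then have "0 \<le> D \<bullet> x" "0 \<le> D \<bullet> (- x)"
      using has_real_derivative_nonneg[OF d, of 0 x] has_real_derivative_nonneg[OF d, of 0 "- x"] by auto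
    then show ?thesis by (simp add: orthogonal_def inner_commute)
  qed
  then have "D \<in> V\<^sup>\<bottom>\<^sup>\<bottom>" by (simp add: orthogonal_comp_def)
  then show ?thesis by (simp add: orthogonal_comp_self V)
qed

section \<open>The energy scalar product and its Euclidean form\<close>

lemma diag_matrix_mult_component: "(diag_matrix a *v x) $ i = a $ i * x $ i"
  by (simp add: diag_matrix_def matrix_vector_mult_def if_distrib[of "\<lambda>x. x * _"] cong: if_cong)

lemma inner_diag_matrix: "x \<bullet> (diag_matrix a *v y) = (\<Sum>i\<in>UNIV. a $ i * x $ i * y $ i)"
  by (simp add: inner_vec_def diag_matrix_mult_component algebra_simps)

text \<open>The square root of \<open>diag_matrix a\<close>: it maps \<open>V\<close> with the \<open>A\<close>-scalar product isometrically into Euclidean space.\<close>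

definition scale_sqrt :: "real^'m \<Rightarrow> real^'m \<Rightarrow> real^'m" where
  "scale_sqrt a x = (\<chi> i. sqrt (a $ i) * x $ i)"

lemma scale_sqrt_linear: "linear (scale_sqrt a)"
  by (rule linearI) (simp_all add: scale_sqrt_def vec_eq_iff algebra_simps)

lemma inner_scale_sqrt:
  assumes "\<forall>i. 0 < a $ i"
  shows "scale_sqrt a x \<bullet> scale_sqrt a y = x \<bullet> (diag_matrix a *v y)"
  using assms
  by (simp add: scale_sqrt_def inner_vec_def diag_matrix_mult_component)
     (rule sum.cong, auto simp: algebra_simps less_imp_le)

lemma scale_sqrt_inj:
  assumes "\<forall>i. 0 < a $ i"
  shows "inj (scale_sqrt a)"
  using assms by (auto simp: inj_def scale_sqrt_def vec_eq_iff) (metis less_irrefl)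

lemma norm_A_diag:
  assumes "\<forall>i. 0 < a $ i"
  shows "norm_A (diag_matrix a) x = norm (scale_sqrt a x)"
  by (simp add: norm_A_def norm_eq_sqrt_inner inner_scale_sqrt[OF assms])

text \<open>The catching-up scheme projects in the Euclidean metric, so it is run on the images of
  \<open>C\<close> and \<open>c\<close> under \<open>scale_sqrt a\<close> and pulled back by the
  inverse \<open>T\<close>. Its inequality then reads in the \<open>A\<close>-scalar product, and at
  points of differentiability it is the normal cone condition.\<close>

theorem sweeping_solution_exists:
  fixes C V :: "(real^'m) set" and c :: "real \<Rightarrow> real^'m"
  assumes a: "\<forall>i. 0 < a $ i" and V: "subspace V" and C: "closed C" "convex C" "C \<subseteq> V"
    and lip: "L-lipschitz_on {t0..} c" and cV: "\<And>t. t \<ge> t0 \<Longrightarrow> c t \<in> V" and x0: "x0 \<in> C"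
  obtains z where "sweeping_solution (diag_matrix a) V (\<lambda>t. (\<lambda>y. y + c t) ` C) t0 z" "z t0 = x0 + c t0"
proof -
  let ?S = "scale_sqrt a" and ?A = "diag_matrix a"
  note lin = scale_sqrt_linear[of a] and inj = scale_sqrt_inj[OF a]
  have bl: "bounded_linear ?S" using lin by (simp add: linear_conv_bounded_linear)
  obtain T where T: "linear T" "T \<circ> ?S = id" using linear_injective_left_inverse[OF lin inj] by blast
  then have TS: "T (?S x) = x" for x by (metis comp_apply id_apply)
  have ST: "?S (T x) = x" for x
    using lin inj TS by (metis linear_injective_imp_surjective surjD)
  have Tbl: "bounded_linear T" using T(1) by (simp add: linear_conv_bounded_linear)
  obtain B where B: "B > 0" "\<And>x. norm (?S x) \<le> norm x * B" using bounded_linear.pos_bounded[OF bl] by blast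
  obtain B' where B': "B' > 0" "\<And>x. norm (T x) \<le> norm x * B'" using bounded_linear.pos_bounded[OF Tbl] by blast
  have L: "L \<ge> 0" using lip by (rule lipschitz_on_nonneg)
  define M where "M = B * L"
  have M: "M \<ge> 0" using B L by (simp add: M_def)
  have "M-lipschitz_on {t0..} (\<lambda>t. ?S (c t))"
  proof (rule lipschitz_onI[OF _ M])
    fix s t assume "s \<in> {t0..}" "t \<in> {t0..}"
    then have "norm (c s - c t) \<le> L * dist s t" using lipschitz_onD[OF lip] by (simp add: dist_norm)
    then have "norm (?S (c s - c t)) \<le> L * dist s t * B"
      by (intro order_trans[OF B(2)] mult_right_mono) (use B(1) in auto)
    then show "dist (?S (c s)) (?S (c t)) \<le> M * dist s t"
      by (simp add: dist_norm M_def linear_diff[OF lin] algebra_simps)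
  qed
  moreover have "closed (?S ` C)" by (rule closed_injective_linear_image[OF C(1) lin inj])
  moreover have "convex (?S ` C)" by (rule convex_linear_image[OF lin C(2)])
  ultimately obtain w where w: "w t0 = ?S x0 + ?S (c t0)" "catch_up_on (?S ` C) (\<lambda>t. ?S (c t)) M {t0..} w"
    using catch_up_limit_exists[of "?S ` C" M t0 "\<lambda>t. ?S (c t)" "?S x0"] x0 by blast
  \<comment> \<open>Constant continuation to the left of \<open>t0\<close> makes \<open>z\<close>
    Lipschitz on the whole line, as the differentiability theorem requires.\<close>
  define z where "z t = T (w (max t t0))" for t
  have Sz: "?S (z t) = w t" if "t \<ge> t0" for t using that by (simp add: z_def ST max_absorb1)
  have zC: "z t - c t \<in> C" if "t \<ge> t0" for t
  proof -
    have "?S (z t - c t) \<in> ?S ` C"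
      using w(2) that by (simp add: catch_up_on_def linear_diff[OF lin] Sz)
    then show ?thesis using inj by (auto dest: injD)
  qed
  then have zV: "z t \<in> V" if "t \<ge> t0" for t
    using subspace_add[OF V, of "z t - c t" "c t"] cV that C(3) by fastforce
  have z_lip: "(M * B')-lipschitz_on UNIV z"
  proof (rule lipschitz_onI)
    fix s t :: real
    have *: "dist (z s) (z t) \<le> M * B' * dist s t" if "s \<le> t" for s t
    proof -
      have "norm (w (max t t0) - w (max s t0)) \<le> M * (max t t0 - max s t0)"
        using w(2) that by (simp add: catch_up_on_def)
      also have "\<dots> \<le> M * dist s t"
        using M that by (intro mult_left_mono) (auto simp: dist_real_def)
      finally have "norm (T (w (max t t0) - w (max s t0))) \<le> M * dist s t * B'"
        by (intro order_trans[OF B'(2)] mult_right_mono) (use B'(1) in auto)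
      then show ?thesis
        by (simp add: z_def dist_norm norm_minus_commute linear_diff[OF T(1)] algebra_simps)
    qed
    show "dist (z s) (z t) \<le> M * B' * dist s t"
      using *[of s t] *[of t s] by (cases "s \<le> t") (auto simp: dist_commute)
  qed (use M B' in simp)
  have var: "- (2 * M\<^sup>2) * (t - s)\<^sup>2 \<le> (z t - z s) \<bullet> (?A *v (\<xi> + c s - z s))"
    if "t0 \<le> s" "s \<le> t" "\<xi> \<in> C" for s t \<xi>
  proof -
    have "- (2 * M\<^sup>2) * (t - s)\<^sup>2 \<le> (w t - w s) \<bullet> (?S \<xi> + ?S (c s) - w s)"
      using w(2) that by (auto simp: catch_up_on_def)
    also have "\<dots> = ?S (z t - z s) \<bullet> ?S (\<xi> + c s - z s)"
      using that by (simp add: linear_diff[OF lin] linear_add[OF lin] Sz)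
    finally show ?thesis by (simp add: inner_scale_sqrt[OF a])
  qed
  have "AE t in lebesgue. t \<in> {t0..} \<longrightarrow> (\<exists>y'. (z has_vector_derivative y') (at t) \<and>
        - y' \<in> normal_cone_A ?A V ((\<lambda>y. y + c t) ` C) (z t))"
    using lipschitz_differentiable_AE[OF z_lip]
  proof (rule eventually_mono, intro impI)
    fix t assume "\<exists>D. (z has_vector_derivative D) (at t)" and t: "t \<in> {t0..}"
    then obtain D where D: "(z has_vector_derivative D) (at t)" by blast
    have "D \<in> V" by (rule vector_derivative_in_subspace[OF D V]) (use zV t in auto)
    have "0 \<le> D \<bullet> (?A *v (\<xi> + c t - z t))" if "\<xi> \<in> C" for \<xi>
    proof (rule has_real_derivative_nonneg)
      show "((\<lambda>s. z s \<bullet> (?A *v (\<xi> + c t - z t))) has_real_derivative D \<bullet> (?A *v (\<xi> + c t - z t))) (at t)"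
        using bounded_linear.has_vector_derivative[OF bounded_linear_inner_left D]
        by (simp add: has_real_derivative_iff_has_vector_derivative)
      fix h :: real assume "h > 0"
      then show "- (2 * M\<^sup>2) * h\<^sup>2 \<le> z (t + h) \<bullet> (?A *v (\<xi> + c t - z t)) - z t \<bullet> (?A *v (\<xi> + c t - z t))"
        using var[of t "t + h" \<xi>] that t by (simp add: inner_diff_left)
    qed
    moreover have "z t \<in> (\<lambda>y. y + c t) ` C"
      using zC[of t] t by (intro image_eqI[of _ _ "z t - c t"]) auto
    ultimately have "- D \<in> normal_cone_A ?A V ((\<lambda>y. y + c t) ` C) (z t)"
      using \<open>D \<in> V\<close> V by (auto simp: normal_cone_A_def subspace_neg)
    then show "\<exists>y'. (z has_vector_derivative y') (at t) \<and> - y' \<in> normal_cone_A ?A V ((\<lambda>y. y + c t) ` C) (z t)"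
      using D by blast
  qed
  moreover have "locally_abs_continuous_from t0 z"
    unfolding locally_abs_continuous_from_def
    using z_lip lipschitz_on_subset lipschitz_imp_abs_continuous_on by blast
  moreover have "z t \<in> (\<lambda>y. y + c t) ` C" if "t \<ge> t0" for t
    using zC[OF that] by (intro image_eqI[of _ _ "z t - c t"]) auto
  ultimately have "sweeping_solution ?A V (\<lambda>t. (\<lambda>y. y + c t) ` C) t0 z"
    using zV unfolding sweeping_solution_def by auto
  moreover have "z t0 = x0 + c t0"
    using w(1) by (simp add: z_def TS linear_add[OF T(1)])
  ultimately show thesis using that by blast
qed

subsection \<open>Dissipation, uniqueness and finite-time convergence\<close>

text \<open>The function \<open>norm (w t, 1)\<close> equals
  \<open>sqrt (w t \<bullet> w t + 1)\<close>. It increases with the norm of \<open>w\<close>,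
  inherits differentiability even at zeros of \<open>w\<close>, and varies no more than
  \<open>w\<close>, hence is absolutely continuous.\<close>

lemma norm_nonincreasing_if_dissipative:
  fixes w :: "real \<Rightarrow> 'a::euclidean_space"
  assumes "a \<le> b" and ac: "abs_continuous_on {a..b} w"
    and AE: "AE t\<in>{a..b} in lebesgue. \<exists>w'. (w has_vector_derivative w') (at t) \<and> w t \<bullet> w' \<le> 0"
  shows "norm (w b) \<le> norm (w a)"
proof -
  define \<phi> where "\<phi> t = norm (w t, 1::real)" for t
  have "\<phi> b \<le> \<phi> a"
  proof (rule abs_continuous_nonincreasing[OF \<open>a \<le> b\<close>])
    show "abs_continuous_on {a..b} \<phi>"
    proof (rule abs_continuous_on_dominated[OF ac ac zero_less_one])
      fix s t
      have "dist (\<phi> s) (\<phi> t) \<le> norm ((w s, 1::real) - (w t, 1))"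
        unfolding \<phi>_def dist_real_def by (rule norm_triangle_ineq3)
      also have "\<dots> = dist (w s) (w t)" by (simp add: norm_Pair dist_norm)
      also have "\<dots> \<le> 1 * (dist (w s) (w t) + dist (w s) (w t))" by simp
      finally show "dist (\<phi> s) (\<phi> t) \<le> 1 * (dist (w s) (w t) + dist (w s) (w t))" .
    qed
    show "AE t\<in>{a..b} in lebesgue. \<exists>D\<le>0. (\<phi> has_real_derivative D) (at t)"
      using AE
    proof (rule eventually_mono, intro impI)
      fix t assume "t \<in> {a..b} \<longrightarrow> (\<exists>w'. (w has_vector_derivative w') (at t) \<and> w t \<bullet> w' \<le> 0)" "t \<in> {a..b}"
      then obtain w' where w': "(w has_vector_derivative w') (at t)" "w t \<bullet> w' \<le> 0" by blast
      have "((\<lambda>t. w t \<bullet> w t) has_vector_derivative (w t \<bullet> w' + w' \<bullet> w t)) (at t)"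
        by (rule bounded_bilinear.has_vector_derivative[OF bounded_bilinear_inner w'(1) w'(1)])
      then have d: "((\<lambda>t. w t \<bullet> w t) has_real_derivative 2 * (w t \<bullet> w')) (at t)"
        by (simp add: has_real_derivative_iff_has_vector_derivative inner_commute)
      have eq: "\<phi> = (\<lambda>t. sqrt (w t \<bullet> w t + 1))"
        by (auto simp: \<phi>_def norm_Pair power2_norm_eq_inner)
      have pos: "w t \<bullet> w t + 1 > 0" by (simp add: add_nonneg_pos)
      have "(\<phi> has_real_derivative (2 * (w t \<bullet> w')) * (inverse (sqrt (w t \<bullet> w t + 1)) / 2)) (at t)"
        unfolding eq using pos by (auto intro!: derivative_eq_intros d)
      moreover have "(2 * (w t \<bullet> w')) * (inverse (sqrt (w t \<bullet> w t + 1)) / 2) \<le> 0"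
        using w'(2) pos by (intro mult_nonpos_nonneg[of "2 * (w t \<bullet> w')"]) auto
      ultimately show "\<exists>D\<le>0. (\<phi> has_real_derivative D) (at t)" by blast
    qed
  qed
  then show ?thesis by (simp add: \<phi>_def norm_Pair)
qed

text \<open>If \<open>w b\<close> were nonzero, monotonicity of the norm would keep \<open>w\<close>
  away from 0 on the whole interval. The norm itself is then differentiable wherever
  \<open>w\<close> is, and it decreases at rate at least \<open>\<epsilon>\<close>, too fast for the
  length of the interval.\<close>

lemma reaches_zero_if_strictly_dissipative:
  fixes w :: "real \<Rightarrow> 'a::euclidean_space"
  assumes "a \<le> b" and ac: "abs_continuous_on {a..b} w" and "\<epsilon> \<ge> 0"
    and AE: "AE t\<in>{a..b} in lebesgue. \<exists>w'. (w has_vector_derivative w') (at t) \<and> w t \<bullet> w' \<le> - \<epsilon> * norm (w t)"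
    and long: "norm (w a) \<le> \<epsilon> * (b - a)"
  shows "w b = 0"
proof (rule ccontr)
  assume "w b \<noteq> 0"
  have nz: "w t \<noteq> 0" if t: "t \<in> {a..b}" for t
  proof -
    have "norm (w b) \<le> norm (w t)"
    proof (rule norm_nonincreasing_if_dissipative)
      show "abs_continuous_on {t..b} w"
        by (rule abs_continuous_on_subset[OF ac]) (use t in auto)
      show "AE s\<in>{t..b} in lebesgue. \<exists>w'. (w has_vector_derivative w') (at s) \<and> w s \<bullet> w' \<le> 0"
        using AE
      proof (rule eventually_mono, intro impI)
        fix s assume s: "s \<in> {a..b} \<longrightarrow> (\<exists>w'. (w has_vector_derivative w') (at s) \<and> w s \<bullet> w' \<le> - \<epsilon> * norm (w s))" "s \<in> {t..b}"
        have "- \<epsilon> * norm (w s) \<le> 0" using \<open>\<epsilon> \<ge> 0\<close> by (simp add: mult_nonneg_nonneg)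
        then show "\<exists>w'. (w has_vector_derivative w') (at s) \<and> w s \<bullet> w' \<le> 0"
          using s t by (meson atLeastAtMost_iff order_trans)
      qed
    qed (use t in simp)
    then show ?thesis using \<open>w b \<noteq> 0\<close> by auto
  qed
  define \<phi> where "\<phi> t = norm (w t) + \<epsilon> * t" for t
  have "\<phi> b \<le> \<phi> a"
  proof (rule abs_continuous_nonincreasing[OF \<open>a \<le> b\<close>])
    show "abs_continuous_on {a..b} \<phi>"
    proof (rule abs_continuous_on_dominated[OF ac abs_continuous_on_id])
      show "0 < 1 + \<epsilon>" using \<open>\<epsilon> \<ge> 0\<close> by simp
      fix s t :: real
      have "dist (\<phi> s) (\<phi> t) \<le> \<bar>norm (w s) - norm (w t)\<bar> + \<bar>\<epsilon> * (s - t)\<bar>"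
        unfolding \<phi>_def dist_real_def by (simp add: right_diff_distrib)
      also have "\<dots> \<le> dist (w s) (w t) + \<epsilon> * dist s t"
        using norm_triangle_ineq3[of "w s" "w t"] \<open>\<epsilon> \<ge> 0\<close> by (simp add: dist_norm dist_real_def abs_mult)
      also have "\<dots> \<le> (1 + \<epsilon>) * (dist (w s) (w t) + dist s t)"
        using \<open>\<epsilon> \<ge> 0\<close> by (simp add: distrib_left distrib_right)
      finally show "dist (\<phi> s) (\<phi> t) \<le> (1 + \<epsilon>) * (dist (w s) (w t) + dist s t)" .
    qed
    show "AE t\<in>{a..b} in lebesgue. \<exists>D\<le>0. (\<phi> has_real_derivative D) (at t)"
      using AE
    proof (rule eventually_mono, intro impI)
      fix t assume *: "t \<in> {a..b} \<longrightarrow> (\<exists>w'. (w has_vector_derivative w') (at t) \<and> w t \<bullet> w' \<le> - \<epsilon> * norm (w t))" "t \<in> {a..b}"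
      then obtain w' where w': "(w has_vector_derivative w') (at t)" "w t \<bullet> w' \<le> - \<epsilon> * norm (w t)" by blast
      have pos: "norm (w t) > 0" using nz *(2) by simp
      then have pos': "w t \<bullet> w t > 0" by simp
      have "((\<lambda>t. w t \<bullet> w t) has_vector_derivative (w t \<bullet> w' + w' \<bullet> w t)) (at t)"
        by (rule bounded_bilinear.has_vector_derivative[OF bounded_bilinear_inner w'(1) w'(1)])
      then have d: "((\<lambda>t. w t \<bullet> w t) has_real_derivative 2 * (w t \<bullet> w')) (at t)"
        by (simp add: has_real_derivative_iff_has_vector_derivative inner_commute)
      have "((\<lambda>t. sqrt (w t \<bullet> w t) + \<epsilon> * t) has_real_derivative
          inverse (sqrt (w t \<bullet> w t)) / 2 * (2 * (w t \<bullet> w')) + \<epsilon>) (at t)"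
        by (intro DERIV_add DERIV_chain2[OF DERIV_real_sqrt[OF pos'] d] DERIV_cmult_Id)
      moreover have "\<phi> = (\<lambda>t. sqrt (w t \<bullet> w t) + \<epsilon> * t)"
        by (rule ext) (simp only: \<phi>_def norm_eq_sqrt_inner)
      moreover have "inverse (sqrt (w t \<bullet> w t)) / 2 * (2 * (w t \<bullet> w')) = (w t \<bullet> w') / norm (w t)"
      proof -
        have "inverse r / 2 * (2 * x) = x / r" for r x :: real by (cases "r = 0") (simp_all add: field_simps)
        then show ?thesis by (simp only: norm_eq_sqrt_inner)
      qed
      ultimately have "(\<phi> has_real_derivative (w t \<bullet> w') / norm (w t) + \<epsilon>) (at t)" by (simp only:)
      moreover have "(w t \<bullet> w') / norm (w t) + \<epsilon> \<le> 0"
        using w'(2) pos by (simp add: field_simps)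
      ultimately show "\<exists>D\<le>0. (\<phi> has_real_derivative D) (at t)" by blast
    qed
  qed
  then have "norm (w b) \<le> 0" using long by (simp add: \<phi>_def right_diff_distrib del: norm_le_zero_iff)
  then show False using \<open>w b \<noteq> 0\<close> by simp
qed

text \<open>Serves two purposes: with \<open>T = 0\<close> it restarts a solution at a later time,
  and with a period \<open>T\<close> it moves a solution to an earlier starting time.\<close>

lemma sweeping_solution_shift:
  assumes z: "sweeping_solution A V K t0 z" and "t0 \<le> t1 + T"
    and K': "\<And>t. t1 \<le> t \<Longrightarrow> K' t = K (t + T)"
  shows "sweeping_solution A V K' t1 (\<lambda>t. z (t + T))"
proof -
  have "abs_continuous_on {t1..b} (\<lambda>t. z (t + T))" if "b \<ge> t1" for b
  proof (rule abs_continuous_on_shift)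
    have "abs_continuous_on {t0..b + T} z"
      using z that assms(2) by (auto simp: sweeping_solution_def locally_abs_continuous_from_def)
    then show "abs_continuous_on {t1 + T..b + T} z"
      by (rule abs_continuous_on_subset) (use assms(2) in auto)
  qed
  moreover have "AE t\<in>{t1..} in lebesgue. \<exists>y'. ((\<lambda>t. z (t + T)) has_vector_derivative y') (at t) \<and>
        - y' \<in> normal_cone_A A V (K' t) (z (t + T))"
  proof -
    define Q where "Q t \<longleftrightarrow> (t \<in> {t0..} \<longrightarrow> (\<exists>y'. (z has_vector_derivative y') (at t) \<and> - y' \<in> normal_cone_A A V (K t) (z t)))" for t
    have "AE t in lebesgue. Q t" using z by (simp add: sweeping_solution_def Q_def)
    then obtain N where N: "negligible N" "{t. \<not> Q t} \<subseteq> N"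
      unfolding eventually_ae_filter_negligible by blast
    have "negligible ((+) (- T) ` N)" by (rule negligible_translation[OF N(1)])
    moreover have "{t. \<not> Q (t + T)} \<subseteq> (+) (- T) ` N"
    proof
      fix t assume "t \<in> {t. \<not> Q (t + T)}"
      then have "t + T \<in> N" using N(2) by blast
      then show "t \<in> (+) (- T) ` N" by (intro image_eqI[of _ _ "t + T"]) auto
    qed
    ultimately have "AE t in lebesgue. Q (t + T)"
      unfolding eventually_ae_filter_negligible by blast
    then show ?thesis
    proof (rule eventually_mono, intro impI)
      fix t assume "Q (t + T)" and t: "t \<in> {t1..}"
      then obtain y' where y': "(z has_vector_derivative y') (at (t + T))" "- y' \<in> normal_cone_A A V (K (t + T)) (z (t + T))"
        using assms(2) unfolding Q_def by auto
      have "((\<lambda>t. t + T) has_real_derivative 1) (at t)" by (auto intro!: derivative_eq_intros)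
      then have "(z \<circ> (\<lambda>t. t + T) has_vector_derivative 1 *\<^sub>R y') (at t)"
        using y'(1) by (intro vector_diff_chain_at) (auto simp: has_real_derivative_iff_has_vector_derivative)
      then show "\<exists>y'. ((\<lambda>t. z (t + T)) has_vector_derivative y') (at t) \<and> - y' \<in> normal_cone_A A V (K' t) (z (t + T))"
        using y'(2) K' t by (auto simp: o_def)
    qed
  qed
  moreover have "z (t + T) \<in> V \<and> z (t + T) \<in> K' t" if "t \<ge> t1" for t
    using z that assms(2) K'[OF that] by (simp add: sweeping_solution_def)
  ultimately show ?thesis
    unfolding sweeping_solution_def locally_abs_continuous_from_def by auto
qed

lemma scale_sqrt_bounded:
  obtains B where "B > 0" "\<forall>x. norm (scale_sqrt a x) \<le> B * norm x"
proof -
  have "bounded_linear (scale_sqrt a)"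
    using scale_sqrt_linear by (simp add: linear_conv_bounded_linear)
  then obtain B where "B > 0" "\<And>x. norm (scale_sqrt a x) \<le> norm x * B"
    using bounded_linear.pos_bounded by blast
  then show thesis using that[of B] by (simp add: mult.commute)
qed

lemma scale_sqrt_derivative:
  "(f has_vector_derivative f') (at t) \<Longrightarrow> ((\<lambda>t. scale_sqrt a (f t)) has_vector_derivative scale_sqrt a f') (at t)"
  using scale_sqrt_linear[of a] linear_conv_bounded_linear bounded_linear.has_vector_derivative by blast

lemma inner_diag_commute: "x \<bullet> (diag_matrix a *v y) = y \<bullet> (diag_matrix a *v x)"
  by (simp add: inner_diag_matrix algebra_simps)

text \<open>Normal cones are monotone: testing each inclusion with the other solution and adding
  shows that the \<open>A\<close>-distance of two solutions cannot grow.\<close>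

lemma sweeping_solution_unique:
  fixes y z :: "real \<Rightarrow> real^'m"
  assumes a: "\<forall>i. 0 < a $ i"
    and y: "sweeping_solution (diag_matrix a) V K t0 y" and z: "sweeping_solution (diag_matrix a) V K t0 z"
    and init: "y t0 = z t0" and "t0 \<le> t"
  shows "y t = z t"
proof -
  let ?A = "diag_matrix a"
  define w where "w s = scale_sqrt a (y s - z s)" for s
  obtain B where B: "B > 0" "\<forall>x. norm (scale_sqrt a x) \<le> B * norm x" by (rule scale_sqrt_bounded[of a])
  have ac: "abs_continuous_on {t0..t} y" "abs_continuous_on {t0..t} z"
    using y z \<open>t0 \<le> t\<close> by (auto simp: sweeping_solution_def locally_abs_continuous_from_def)
  have "norm (w t) \<le> norm (w t0)"
  proof (rule norm_nonincreasing_if_dissipative[OF \<open>t0 \<le> t\<close>])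
    show "abs_continuous_on {t0..t} w"
    proof (rule abs_continuous_on_dominated[OF ac B(1)])
      fix r s
      have "dist (w r) (w s) = norm (scale_sqrt a ((y r - z r) - (y s - z s)))"
        by (simp add: w_def dist_norm linear_diff[OF scale_sqrt_linear])
      also have "(y r - z r) - (y s - z s) = (y r - y s) - (z r - z s)" by simp
      also have "norm (scale_sqrt a \<dots>) \<le> B * norm ((y r - y s) - (z r - z s))" using B(2) by blast
      also have "\<dots> \<le> B * (dist (y r) (y s) + dist (z r) (z s))"
        using B(1) norm_triangle_ineq4 by (intro mult_left_mono) (auto simp: dist_norm)
      finally show "dist (w r) (w s) \<le> B * (dist (y r) (y s) + dist (z r) (z s))" .
    qed
    have "AE s in lebesgue. (s \<in> {t0..} \<longrightarrow> (\<exists>y'. (y has_vector_derivative y') (at s) \<and> - y' \<in> normal_cone_A ?A V (K s) (y s))) \<and>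
       (s \<in> {t0..} \<longrightarrow> (\<exists>z'. (z has_vector_derivative z') (at s) \<and> - z' \<in> normal_cone_A ?A V (K s) (z s)))"
      using y z by (intro eventually_conj) (auto simp: sweeping_solution_def)
    then show "AE s\<in>{t0..t} in lebesgue. \<exists>w'. (w has_vector_derivative w') (at s) \<and> w s \<bullet> w' \<le> 0"
    proof (rule eventually_mono, intro impI)
      fix s assume *: "(s \<in> {t0..} \<longrightarrow> (\<exists>y'. (y has_vector_derivative y') (at s) \<and> - y' \<in> normal_cone_A ?A V (K s) (y s))) \<and>
       (s \<in> {t0..} \<longrightarrow> (\<exists>z'. (z has_vector_derivative z') (at s) \<and> - z' \<in> normal_cone_A ?A V (K s) (z s)))" "s \<in> {t0..t}"
      then obtain y' z' where y': "(y has_vector_derivative y') (at s)" "- y' \<in> normal_cone_A ?A V (K s) (y s)"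
        and z': "(z has_vector_derivative z') (at s)" "- z' \<in> normal_cone_A ?A V (K s) (z s)"
        by auto
      have "y s \<in> K s" "z s \<in> K s"
        using y z *(2) by (auto simp: sweeping_solution_def)
      then have "- y' \<bullet> (?A *v (z s - y s)) \<le> 0" "- z' \<bullet> (?A *v (y s - z s)) \<le> 0"
        using y'(2) z'(2) by (auto simp: normal_cone_A_def)
      then have "(y' - z') \<bullet> (?A *v (y s - z s)) \<le> 0"
        by (simp add: matrix_vector_mult_diff_distrib inner_diff_left inner_diff_right)
      then have "w s \<bullet> scale_sqrt a (y' - z') \<le> 0"
        by (simp add: w_def inner_commute inner_scale_sqrt[OF a] inner_diag_commute)
      moreover have "(w has_vector_derivative scale_sqrt a (y' - z')) (at s)"
        unfolding w_def by (intro scale_sqrt_derivative has_vector_derivative_diff y' z')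
      ultimately show "\<exists>w'. (w has_vector_derivative w') (at s) \<and> w s \<bullet> w' \<le> 0" by blast
    qed
  qed
  then have "w t = 0" using init by (simp add: w_def linear_0[OF scale_sqrt_linear])
  then have "scale_sqrt a (y t - z t) = scale_sqrt a 0" by (simp add: w_def linear_0[OF scale_sqrt_linear])
  then show ?thesis using injD[OF scale_sqrt_inj[OF a]] by fastforce
qed

text \<open>Let \<open>d\<close> be the offset of \<open>y - c\<close> from the corner. Testing the
  process with the moving corner \<open>y0 + c s\<close> gives that \<open>y'\<close> has
  nonpositive \<open>A\<close>-product with \<open>d\<close>; testing the ball inclusion with the
  point \<open>y s - c s\<close> of \<open>C\<close> shows that \<open>- c'\<close> has
  \<open>A\<close>-product at most \<open>- \<epsilon>\<close> times the \<open>A\<close>-norm of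
  \<open>d\<close>. The sum is the decay rate of \<open>d\<close>.\<close>

lemma sweeping_solution_reaches_corner:
  fixes y :: "real \<Rightarrow> real^'m"
  assumes a: "\<forall>i. 0 < a $ i" and y: "sweeping_solution (diag_matrix a) V (\<lambda>t. (\<lambda>x. x + c t) ` C) 0 y"
    and lip: "L-lipschitz_on {0..} c" and CV: "C \<subseteq> V" "subspace V" and y0: "y0 \<in> C" and "0 \<le> \<tau>" "0 \<le> \<epsilon>"
    and AE: "AE t\<in>{0..\<tau>} in lebesgue. \<exists>c'. (c has_vector_derivative c') (at t) \<and>
        (\<forall>x\<in>ball_A (diag_matrix a) V \<epsilon>. - c' + x \<in> normal_cone_A (diag_matrix a) V C y0)"
    and far: "\<And>x. x \<in> C \<Longrightarrow> norm_A (diag_matrix a) (x - y0) \<le> \<epsilon> * \<tau>"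
  shows "y \<tau> = y0 + c \<tau>"
proof -
  let ?A = "diag_matrix a" and ?S = "scale_sqrt a"
  define w where "w s = ?S (y s - c s - y0)" for s
  obtain B where B: "B > 0" "\<forall>x. norm (?S x) \<le> B * norm x" by (rule scale_sqrt_bounded[of a])
  have ac: "abs_continuous_on {0..\<tau>} y" "abs_continuous_on {0..\<tau>} c"
    using y \<open>0 \<le> \<tau>\<close> lipschitz_imp_abs_continuous_on[OF lipschitz_on_subset[OF lip]]
    by (auto simp: sweeping_solution_def locally_abs_continuous_from_def)
  have yC: "y t - c t \<in> C" if "t \<ge> 0" for t
    using y that by (auto simp: sweeping_solution_def)
  have "w \<tau> = 0"
  proof (rule reaches_zero_if_strictly_dissipative[OF \<open>0 \<le> \<tau>\<close> _ \<open>0 \<le> \<epsilon>\<close>])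
    show "abs_continuous_on {0..\<tau>} w"
    proof (rule abs_continuous_on_dominated[OF ac B(1)])
      fix r s
      have "dist (w r) (w s) = norm (?S ((y r - c r - y0) - (y s - c s - y0)))"
        unfolding w_def dist_norm linear_diff[OF scale_sqrt_linear] ..
      also have "(y r - c r - y0) - (y s - c s - y0) = (y r - y s) - (c r - c s)" by simp
      also have "norm (?S \<dots>) \<le> B * norm ((y r - y s) - (c r - c s))" using B(2) by blast
      also have "\<dots> \<le> B * (dist (y r) (y s) + dist (c r) (c s))"
        using B(1) norm_triangle_ineq4 by (intro mult_left_mono) (auto simp: dist_norm)
      finally show "dist (w r) (w s) \<le> B * (dist (y r) (y s) + dist (c r) (c s))" .
    qed
    show "norm (w 0) \<le> \<epsilon> * (\<tau> - 0)"
      using far[OF yC[of 0]] by (simp add: w_def norm_A_diag[OF a])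
    have "AE s in lebesgue. (s \<in> {0..} \<longrightarrow> (\<exists>y'. (y has_vector_derivative y') (at s) \<and> - y' \<in> normal_cone_A ?A V ((\<lambda>x. x + c s) ` C) (y s))) \<and>
       (s \<in> {0..\<tau>} \<longrightarrow> (\<exists>c'. (c has_vector_derivative c') (at s) \<and> (\<forall>x\<in>ball_A ?A V \<epsilon>. - c' + x \<in> normal_cone_A ?A V C y0)))"
      using y AE by (intro eventually_conj) (auto simp: sweeping_solution_def)
    then show "AE s\<in>{0..\<tau>} in lebesgue. \<exists>w'. (w has_vector_derivative w') (at s) \<and> w s \<bullet> w' \<le> - \<epsilon> * norm (w s)"
    proof (rule eventually_mono, intro impI)
      fix s assume *: "(s \<in> {0..} \<longrightarrow> (\<exists>y'. (y has_vector_derivative y') (at s) \<and> - y' \<in> normal_cone_A ?A V ((\<lambda>x. x + c s) ` C) (y s))) \<and>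
       (s \<in> {0..\<tau>} \<longrightarrow> (\<exists>c'. (c has_vector_derivative c') (at s) \<and> (\<forall>x\<in>ball_A ?A V \<epsilon>. - c' + x \<in> normal_cone_A ?A V C y0)))" "s \<in> {0..\<tau>}"
      then obtain y' c' where y': "(y has_vector_derivative y') (at s)" "- y' \<in> normal_cone_A ?A V ((\<lambda>x. x + c s) ` C) (y s)"
        and c': "(c has_vector_derivative c') (at s)" "\<forall>x\<in>ball_A ?A V \<epsilon>. - c' + x \<in> normal_cone_A ?A V C y0"
        by auto
      define d where "d = y s - c s - y0"
      have xC: "y s - c s \<in> C" using yC *(2) by simp
      have nd: "norm_A ?A d = norm (w s)" by (simp add: d_def w_def norm_A_diag[OF a])
      have dV: "d \<in> V"
        unfolding d_def using xC y0 CV(1) by (intro subspace_diff[OF CV(2), of "y s - c s"]) auto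
      have dd: "d \<bullet> (?A *v d) = norm (w s) * norm (w s)"
        by (simp add: w_def d_def inner_scale_sqrt[OF a, symmetric] norm_eq_sqrt_inner)
      have "- y' \<bullet> (?A *v (y0 + c s - y s)) \<le> 0"
        using y'(2) y0 by (auto simp: normal_cone_A_def split: if_splits)
      moreover have "y0 + c s - y s = - d" by (simp add: d_def)
      ultimately have 1: "y' \<bullet> (?A *v d) \<le> 0"
        by (simp add: matrix_vector_mult_diff_distrib d_def inner_diff_right matrix_vector_right_distrib inner_add_right)
      have 2: "- c' \<bullet> (?A *v d) \<le> - \<epsilon> * norm (w s)"
      proof (cases "norm (w s) = 0")
        case True
        then have "scale_sqrt a d = scale_sqrt a 0" by (simp add: w_def d_def linear_0[OF scale_sqrt_linear])
        then have "d = 0" by (rule injD[OF scale_sqrt_inj[OF a]])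
        then show ?thesis using True by simp
      next
        case False
        \<comment> \<open>The extreme perturbation in the ball: \<open>A\<close>-norm
          \<open>\<epsilon>\<close>, in the direction from the corner to the current
          position.\<close>
        define u where "u = (\<epsilon> / norm (w s)) *\<^sub>R d"
        have "norm_A ?A u = \<epsilon>"
          using False nd \<open>0 \<le> \<epsilon>\<close> by (simp add: u_def norm_A_diag[OF a] linear_cmul[OF scale_sqrt_linear])
        then have "u \<in> ball_A ?A V \<epsilon>"
          using dV CV by (simp add: ball_A_def u_def subspace_scale)
        then have "(- c' + u) \<bullet> (?A *v (y s - c s - y0)) \<le> 0"
          using c'(2) xC y0 by (auto simp: normal_cone_A_def)
        moreover have "u \<bullet> (?A *v d) = \<epsilon> * norm (w s)"
          using False by (simp add: u_def dd)
        ultimately show ?thesis by (simp add: d_def[symmetric] inner_diff_left inner_add_left)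
      qed
      have "w s \<bullet> ?S (y' - c') = (y' - c') \<bullet> (?A *v d)"
        by (simp add: w_def d_def inner_scale_sqrt[OF a] inner_diag_commute)
      also have "\<dots> \<le> - \<epsilon> * norm (w s)" using 1 2 by (simp add: inner_diff_left)
      finally have "w s \<bullet> ?S (y' - c') \<le> - \<epsilon> * norm (w s)" .
      moreover have "(w has_vector_derivative ?S (y' - c' - 0)) (at s)"
        unfolding w_def by (intro scale_sqrt_derivative has_vector_derivative_diff y' c' has_vector_derivative_const)
      ultimately show "\<exists>w'. (w has_vector_derivative w') (at s) \<and> w s \<bullet> w' \<le> - \<epsilon> * norm (w s)" by auto
    qed
  qed
  then have "?S (y \<tau> - c \<tau> - y0) = ?S 0" by (simp add: w_def linear_0[OF scale_sqrt_linear])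
  then have "y \<tau> - c \<tau> - y0 = 0" by (rule injD[OF scale_sqrt_inj[OF a]])
  then show ?thesis by (simp add: algebra_simps)
qed

subsection \<open>Normals of the springs and the corner\<close>

lemma P_matrix_mult_component:
  "(P_matrix R Dperp *v v) $ None = R \<bullet> v"
  "(P_matrix R Dperp *v v) $ Some k = (transpose Dperp *v v) $ k"
  by (simp_all add: P_matrix_def matrix_vector_mult_def inner_vec_def column_def transpose_def)

lemma P_matrix_kernel:
  "P_matrix R Dperp *v v = 0 \<longleftrightarrow> R \<bullet> v = 0 \<and> transpose Dperp *v v = 0"
proof -
  have "P_matrix R Dperp *v v = 0 \<longleftrightarrow> (\<forall>i. (P_matrix R Dperp *v v) $ i = 0)"
    by (simp add: vec_eq_iff)
  also have "\<dots> \<longleftrightarrow> R \<bullet> v = 0 \<and> transpose Dperp *v v = 0"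
    by (simp add: P_matrix_mult_component vec_eq_iff split_option_all del: transpose_matrix_vector)
  finally show ?thesis .
qed

text \<open>Rank-nullity, read off from the kernel being the orthogonal complement of the row
  space.\<close>

lemma dim_kernel:
  fixes M :: "real^'n^'m"
  shows "dim {x. M *v x = 0} + rank M = CARD('n)"
proof -
  have "{x. M *v x = 0} = {y \<in> UNIV. \<forall>x \<in> span (rows M). orthogonal x y}"
  proof (intro subset_antisym subsetI)
    fix y assume "y \<in> {x. M *v x = 0}"
    then show "y \<in> {y \<in> UNIV. \<forall>x \<in> span (rows M). orthogonal x y}"
      using orthogonal_nullspace_rowspace orthogonal_commute by blast
  next
    fix y assume y: "y \<in> {y \<in> UNIV. \<forall>x \<in> span (rows M). orthogonal x y}"
    have "row i M \<bullet> y = 0" for i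
      using y span_base[of "row i M" "rows M"] by (auto simp: orthogonal_def rows_def)
    then show "y \<in> {x. M *v x = 0}"
      by (simp add: vec_eq_iff matrix_mult_dot row_def inner_commute)
  qed
  then have "dim {x. M *v x = 0} + dim (span (rows M)) = dim (UNIV :: (real^'n) set)"
    using dim_subspace_orthogonal_to_vectors[of "span (rows M)" UNIV] by simp
  then show ?thesis by (simp add: row_rank_def)
qed

text \<open>The kernel of the transpose of \<open>Dperp\<close> is the range of \<open>D\<close>, of
  dimension \<open>n - 1\<close>. The row \<open>R\<close> cuts out of it a proper subspace, of
  dimension at most \<open>n - 2\<close>, which contains the \<open>n - 2\<close> independent
  columns of \<open>DQ\<close>. This ties \<open>P\<close> to the vectors that are
  \<open>A\<close>-orthogonal to \<open>V\<close>.\<close>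

lemma P_matrix_kernel_eq_span:
  fixes D :: "real^'n^'m" and Q :: "nat \<Rightarrow> real^'n" and Dperp :: "real^'k::finite^'m" and R :: "real^'m"
  assumes n: "2 \<le> CARD('n)" "CARD('n) \<le> CARD('m)"
    and D: "rank D = CARD('n) - 1" and R: "rank (transpose D ** (columnvector R :: real^1^'m)) = 1"
    and Q: "dim ((\<lambda>i. D *v Q i) ` {..<CARD('n) - 2}) = CARD('n) - 2" "\<forall>i<CARD('n) - 2. R \<bullet> (D *v Q i) = 0"
    and Dperp: "rank Dperp = CARD('m) - CARD('n) + 1" "transpose Dperp ** D = 0"
  shows "{v. P_matrix R Dperp *v v = 0} = span ((\<lambda>i. D *v Q i) ` {..<CARD('n) - 2})" (is "?N = ?U")
proof -
  define Z where "Z = {v. transpose Dperp *v v = 0}"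
  have subsp: "subspace ?N" "subspace Z" "subspace (range ((*v) D))"
    unfolding Z_def
    by (auto intro!: subspaceI linear_subspace_image simp: matrix_vector_right_distrib matrix_vector_mult_scaleR simp del: transpose_matrix_vector)
  have "dim Z + rank (transpose Dperp) = CARD('m)" unfolding Z_def by (rule dim_kernel)
  then have dimZ: "dim Z = CARD('n) - 1" using Dperp(1) n by (simp add: rank_transpose)
  have DZ: "transpose Dperp *v (D *v x) = 0" for x
    by (simp add: matrix_vector_mul_assoc Dperp(2))
  have "range ((*v) D) = Z"
  proof (rule subspace_dim_equal[OF subsp(3,2)])
    show "range ((*v) D) \<subseteq> Z" using DZ by (auto simp: Z_def)
    show "dim Z \<le> dim (range ((*v) D))" using dimZ D rank_dim_range[of D] by simp
  qed
  have NZ: "?N \<subseteq> Z" by (auto simp: P_matrix_kernel Z_def)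
  \<comment> \<open>Otherwise \<open>R\<close> would be orthogonal to the whole range of
    \<open>D\<close>, contradicting that \<open>transpose D\<close> applied to \<open>R\<close> has
    rank 1.\<close>
  have "dim ?N \<noteq> CARD('n) - 1"
  proof
    assume "dim ?N = CARD('n) - 1"
    then have "?N = Z" using subspace_dim_equal[OF subsp(1,2) NZ] dimZ by simp
    then have "R \<bullet> (D *v x) = 0" for x
      using \<open>range ((*v) D) = Z\<close> by (auto simp: P_matrix_kernel)
    then have "(R v* D) \<bullet> x = 0" for x by (simp add: dot_lmul_matrix)
    then have "transpose D *v R = 0" by (metis inner_eq_zero_iff vector_transpose_matrix transpose_transpose)
    then have "transpose D ** (columnvector R :: real^1^'m) = 0"
      by (simp add: vec_eq_iff matrix_matrix_mult_def matrix_vector_mult_def columnvector_def)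
    then show False using R by simp
  qed
  moreover have "dim ?N \<le> CARD('n) - 1" using dim_subset[OF NZ] dimZ by simp
  ultimately have dimN: "dim ?N \<le> dim ?U" using Q(1) by simp
  have "?U \<subseteq> ?N"
    by (rule span_minimal[OF _ subsp(1)]) (use Q(2) DZ in \<open>auto simp: P_matrix_kernel\<close>)
  then show ?thesis
    using subspace_dim_equal[OF subspace_span subsp(1) _ dimN] by blast
qed

lemma matrix_inv_right:
  assumes "invertible M"
  shows "M ** matrix_inv M = mat 1"
  using someI_ex[OF assms[unfolded invertible_def]] unfolding matrix_inv_def by simp

text \<open>Since \<open>W_inv\<close> inverts \<open>P\<close> on the range of
  \<open>Vbasis\<close>, the normal and \<open>axis j 1\<close> have the same image under
  \<open>P\<close>. Their difference lies in the kernel of \<open>P\<close>, the span of the columns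
  of \<open>DQ\<close>, which is \<open>A\<close>-orthogonal to \<open>V\<close>.\<close>

lemma spring_normal_inner:
  fixes D :: "real^'n^'m" and Q :: "nat \<Rightarrow> real^'n" and Dperp :: "real^'k::finite^'m" and R a :: "real^'m"
    and Vbasis :: "real^('k option)^'m"
  assumes a: "\<forall>j. 0 < a $ j"
    and ker: "{v. P_matrix R Dperp *v v = 0} = span ((\<lambda>i. D *v Q i) ` I)"
    and Vb: "inj (\<lambda>k. column k Vbasis)" "independent (columns Vbasis)"
    and orth: "\<forall>i\<in>I. (D *v Q i) v* (diag_matrix a ** Vbasis) = 0"
    and y: "y \<in> range (\<lambda>x. Vbasis *v x)"
  shows "spring_normal R Dperp Vbasis j \<bullet> (diag_matrix a *v y) = axis j 1 \<bullet> (diag_matrix a *v y)"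
proof -
  let ?A = "diag_matrix a" and ?W = "P_matrix R Dperp ** Vbasis" and ?P = "P_matrix R Dperp"
  have perp: "u \<bullet> (?A *v (Vbasis *v b)) = 0" if "?P *v u = 0" for u b
  proof -
    have "u \<in> span ((\<lambda>i. D *v Q i) ` I)" using that ker by blast
    moreover have "span ((\<lambda>i. D *v Q i) ` I) \<subseteq> {u. u \<bullet> (?A *v (Vbasis *v b)) = 0}"
    proof (rule span_minimal)
      show "subspace {u. u \<bullet> (?A *v (Vbasis *v b)) = 0}"
        by (auto intro!: subspaceI simp: inner_add_left)
      show "(\<lambda>i. D *v Q i) ` I \<subseteq> {u. u \<bullet> (?A *v (Vbasis *v b)) = 0}"
      proof clarify
        fix i assume "i \<in> I"
        then have "((D *v Q i) v* (?A ** Vbasis)) \<bullet> b = 0" using orth by simp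
        then show "(D *v Q i) \<bullet> (?A *v (Vbasis *v b)) = 0"
          by (simp add: dot_lmul_matrix matrix_vector_mul_assoc)
      qed
    qed
    ultimately show ?thesis by blast
  qed
  have "rank Vbasis = CARD('k option)"
  proof -
    have "card (columns Vbasis) = CARD('k option)"
      using card_image[OF Vb(1)] by (simp add: columns_def full_SetCompr_eq)
    then show ?thesis using Vb(2) by (simp add: column_rank_def dim_eq_card_independent)
  qed
  then have Vinj: "inj ((*v) Vbasis)" by (simp only: full_rank_injective)
  \<comment> \<open>A vector of \<open>V\<close> in the kernel of \<open>P\<close> is
    \<open>A\<close>-orthogonal to all of \<open>V\<close>, in particular to itself.\<close>
  have "x = 0" if "?W *v x = 0" for x
  proof -
    have "?P *v (Vbasis *v x) = 0" using that by (simp add: matrix_vector_mul_assoc)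
    then have "(Vbasis *v x) \<bullet> (?A *v (Vbasis *v x)) = 0" by (rule perp)
    then have "scale_sqrt a (Vbasis *v x) = 0"
      by (simp add: inner_scale_sqrt[OF a, symmetric])
    then have "Vbasis *v x = 0"
      using injD[OF scale_sqrt_inj[OF a], of "Vbasis *v x" 0] linear_0[OF scale_sqrt_linear[of a]] by simp
    then show ?thesis using Vinj by (metis injD matrix_vector_mult_0_right)
  qed
  then have "invertible ?W"
    by (simp add: invertible_left_inverse matrix_left_invertible_ker)
  then have Winv: "?W ** W_inv R Dperp Vbasis = mat 1"
    unfolding W_inv_def by (rule matrix_inv_right)
  have "?P *v spring_normal R Dperp Vbasis j = ?P *v axis j 1"
    unfolding spring_normal_def
    by (simp only: matrix_vector_mul_assoc Winv[unfolded matrix_mul_assoc] matrix_mul_assoc) (simp add: Winv matrix_vector_mul_assoc)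
  then have "?P *v (spring_normal R Dperp Vbasis j - axis j 1) = 0"
    by (simp add: matrix_vector_mult_diff_distrib)
  moreover obtain b where "y = Vbasis *v b" using y by blast
  ultimately have "(spring_normal R Dperp Vbasis j - axis j 1) \<bullet> (?A *v y) = 0"
    using perp by simp
  then show ?thesis by (simp add: inner_diff_left)
qed

section \<open>Cones and spans of indexed families\<close>

text \<open>Since \<open>f\<close> may take a value at several indices, the whole coefficient of a
  vector is charged to the one index that \<open>inv_into\<close> selects, and the other indices get
  0.\<close>

lemma sum_over_image_section:
  fixes f :: "'i \<Rightarrow> 'a::real_vector"
  assumes "finite I" "X \<subseteq> f ` I"
  shows "(\<Sum>x\<in>X. u x *\<^sub>R x) = (\<Sum>i\<in>I. (if i \<in> inv_into I f ` X then u (f i) else 0) *\<^sub>R f i)"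
proof -
  let ?g = "inv_into I f"
  have g: "?g x \<in> I" "f (?g x) = x" if "x \<in> X" for x
    using that assms(2) by (auto intro: inv_into_into f_inv_into_f)
  have "(\<Sum>i\<in>I. (if i \<in> ?g ` X then u (f i) else 0) *\<^sub>R f i) = (\<Sum>i\<in>?g ` X. u (f i) *\<^sub>R f i)"
    using assms(1) g(1) by (intro sum.mono_neutral_cong_right) auto
  also have "\<dots> = (\<Sum>x\<in>X. u (f (?g x)) *\<^sub>R f (?g x))"
    by (rule sum.reindex_cong[OF inj_on_inv_into[OF assms(2)]]) auto
  also have "\<dots> = (\<Sum>x\<in>X. u x *\<^sub>R x)" using g(2) by (intro sum.cong) auto
  finally show ?thesis by simp
qed

lemma nonneg_combinations_imageE:
  assumes "finite I" "v \<in> nonneg_combinations (f ` I)"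
  obtains r where "\<forall>i. 0 \<le> r i" "v = (\<Sum>i\<in>I. r i *\<^sub>R f i)"
proof -
  obtain X u where X: "X \<subseteq> f ` I" "\<forall>x\<in>X. 0 \<le> u x" "v = (\<Sum>x\<in>X. u x *\<^sub>R x)"
    using assms(2) unfolding nonneg_combinations_def by blast
  have "0 \<le> (if i \<in> inv_into I f ` X then u (f i) else 0)" for i
    using X(1,2) by (auto simp: f_inv_into_f subset_iff)
  then show thesis
    using that[of "\<lambda>i. if i \<in> inv_into I f ` X then u (f i) else 0"] X(3) sum_over_image_section[OF assms(1) X(1), where u = u]
    by simp
qed

lemma span_imageE:
  fixes f :: "'i \<Rightarrow> 'a::real_vector"
  assumes "finite I" "v \<in> span (f ` I)"
  obtains \<nu> where "v = (\<Sum>i\<in>I. \<nu> i *\<^sub>R f i)"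
proof -
  obtain u where "v = (\<Sum>x\<in>f ` I. u x *\<^sub>R x)"
    using assms span_finite[of "f ` I"] by auto
  then show thesis
    using that sum_over_image_section[OF assms(1) order_refl, where f = f and u = u] by simp
qed

text \<open>Were the coefficient of \<open>f p\<close> in \<open>g + x\<close> negative, it would
  vanish at some \<open>g + \<theta> *\<^sub>R x\<close> with \<open>\<theta> < 1\<close>. That
  point lies in the span of the remaining vectors at \<open>A\<close>-distance at most
  \<open>\<theta> * \<epsilon>\<close> from \<open>g\<close>, closer than the hypothesis on
  distances allows.\<close>

lemma diff_combination_in_cone:
  fixes f :: "'i \<Rightarrow> real^'m"
  assumes a: "\<forall>i. 0 < a $ i" and I: "finite I" and g: "g = (\<Sum>i\<in>I. r i *\<^sub>R f i)" "\<And>i. 0 \<le> r i"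
    and dist: "\<And>i. i \<in> I \<Longrightarrow> \<epsilon> \<le> dist_A (diag_matrix a) g (span (f ` (I - {i})))"
    and x: "x \<in> span (f ` I)" "norm_A (diag_matrix a) x \<le> \<epsilon>" and "0 < \<epsilon>"
  obtains \<mu> where "\<forall>i\<in>I. 0 \<le> \<mu> i" "g + x = (\<Sum>i\<in>I. \<mu> i *\<^sub>R f i)"
proof -
  obtain \<nu> where \<nu>: "x = (\<Sum>i\<in>I. \<nu> i *\<^sub>R f i)" using span_imageE[OF I x(1)] .
  have "\<forall>p\<in>I. 0 \<le> r p + \<nu> p"
  proof (intro ballI, rule ccontr)
    fix p assume p: "p \<in> I" and neg: "\<not> 0 \<le> r p + \<nu> p"
    then have \<nu>p: "\<nu> p < 0" using g(2)[of p] by linarith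
    define \<theta> where "\<theta> = r p / - \<nu> p"
    have \<theta>: "0 \<le> \<theta>" "\<theta> < 1" using g(2)[of p] \<nu>p neg by (auto simp: \<theta>_def field_simps)
    have zero: "r p + \<theta> * \<nu> p = 0" using \<nu>p by (simp add: \<theta>_def)
    have "g + \<theta> *\<^sub>R x = (\<Sum>i\<in>I. (r i + \<theta> * \<nu> i) *\<^sub>R f i)"
      by (simp add: g(1) \<nu> scaleR_sum_right scaleR_left_distrib sum.distrib)
    also have "\<dots> = (\<Sum>i\<in>I - {p}. (r i + \<theta> * \<nu> i) *\<^sub>R f i)"
      using zero by (simp add: sum.remove[OF I p])
    also have "\<dots> \<in> span (f ` (I - {p}))"
      by (intro span_sum span_scale span_base) auto
    finally have "g + \<theta> *\<^sub>R x \<in> span (f ` (I - {p}))" .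
    then have "dist_A (diag_matrix a) g (span (f ` (I - {p}))) \<le> norm_A (diag_matrix a) (g - (g + \<theta> *\<^sub>R x))"
      unfolding dist_A_def
      by (intro cINF_lower bdd_belowI2[of _ 0]) (auto simp: norm_A_diag[OF a])
    also have "\<dots> = \<theta> * norm_A (diag_matrix a) x"
      using \<theta>(1) linear_cmul[OF scale_sqrt_linear, of a "- \<theta>" x] by (simp add: norm_A_diag[OF a])
    also have "\<dots> \<le> \<theta> * \<epsilon>" using x(2) \<theta>(1) by (rule mult_left_mono)
    also have "\<dots> < \<epsilon>" using \<theta>(2) \<open>0 < \<epsilon>\<close> by simp
    finally show False using dist[OF p] by simp
  qed
  moreover have "g + x = (\<Sum>i\<in>I. (r i + \<nu> i) *\<^sub>R f i)"
    by (simp add: g(1) \<nu> scaleR_left_distrib sum.distrib)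
  ultimately show thesis by (rule that[of "\<lambda>i. r i + \<nu> i"])
qed

text \<open>If the span were smaller than \<open>V\<close>, some nonzero vector of \<open>V\<close>
  would be \<open>A\<close>-orthogonal to it. Uniqueness of the corner supplies the separation
  hypothesis for the normals of \<open>I0\<close>.\<close>

lemma subspace_eq_span_if_separating:
  fixes f :: "'i \<Rightarrow> real^'m"
  assumes a: "\<forall>i. 0 < a $ i" and V: "subspace V" and f: "f ` I \<subseteq> V"
    and sep: "\<And>y. y \<in> V \<Longrightarrow> (\<forall>i\<in>I. f i \<bullet> (diag_matrix a *v y) = 0) \<Longrightarrow> y = 0"
  shows "V \<subseteq> span (f ` I)"
proof (rule ccontr)
  let ?S = "scale_sqrt a"
  assume "\<not> V \<subseteq> span (f ` I)"
  moreover have "span (f ` I) \<subseteq> V" by (rule span_minimal[OF f V])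
  ultimately have "?S ` span (f ` I) \<subset> ?S ` V"
    using scale_sqrt_inj[OF a] by (simp add: psubset_eq inj_image_eq_iff image_mono)
  then have "span (?S ` span (f ` I)) \<subset> span (?S ` V)"
    using linear_subspace_image[OF scale_sqrt_linear] V by (metis span_eq_iff subspace_span)
  then obtain w where w: "w \<noteq> 0" "w \<in> span (?S ` V)" "\<And>z. z \<in> span (?S ` span (f ` I)) \<Longrightarrow> orthogonal w z"
    using orthogonal_to_subspace_exists_gen by blast
  moreover have "span (?S ` V) = ?S ` V"
    using linear_subspace_image[OF scale_sqrt_linear V] by (simp add: span_eq_iff)
  ultimately obtain y where y: "y \<in> V" "w = ?S y" by auto
  have "f i \<bullet> (diag_matrix a *v y) = 0" if "i \<in> I" for i
  proof -
    have "?S (f i) \<in> span (?S ` span (f ` I))" using that by (auto intro!: span_base)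
    then have "orthogonal w (?S (f i))" by (rule w(3))
    then have "?S (f i) \<bullet> ?S y = 0"
      using y(2) by (simp add: orthogonal_def inner_commute[of "?S (f i)"])
    then show ?thesis by (simp add: inner_scale_sqrt[OF a])
  qed
  then have "y = 0" using sep y(1) by blast
  then show False using w(1) y(2) linear_0[OF scale_sqrt_linear[of a]] by simp
qed

lemma span_scaled_image:
  fixes f :: "'i \<Rightarrow> 'a::real_vector"
  assumes "\<And>i. i \<in> J \<Longrightarrow> r i \<noteq> 0"
  shows "span ((\<lambda>i. r i *\<^sub>R f i) ` J) = span (f ` J)"
proof (subst span_eq, intro conjI)
  show "(\<lambda>i. r i *\<^sub>R f i) ` J \<subseteq> span (f ` J)"
  proof clarify
    fix i assume "i \<in> J"
    then have "f i \<in> span (f ` J)" by (simp add: span_base)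
    then show "r i *\<^sub>R f i \<in> span (f ` J)" by (rule span_scale)
  qed
  show "f ` J \<subseteq> span ((\<lambda>i. r i *\<^sub>R f i) ` J)"
  proof clarify
    fix i assume i: "i \<in> J"
    then have "r i *\<^sub>R f i \<in> span ((\<lambda>i. r i *\<^sub>R f i) ` J)" by (auto intro: span_base)
    then have "inverse (r i) *\<^sub>R (r i *\<^sub>R f i) \<in> span ((\<lambda>i. r i *\<^sub>R f i) ` J)" by (rule span_scale)
    then show "f i \<in> span ((\<lambda>i. r i *\<^sub>R f i) ` J)" using assms[OF i] by simp
  qed
qed

section \<open>The elastic set and its normal cone at the corner\<close>

lemma axis_inner_diag: "axis j 1 \<bullet> (diag_matrix a *v y) = a $ j * y $ j"
  by (simp add: inner_axis' diag_matrix_mult_component)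

lemma elastic_set_closed_convex:
  assumes "subspace V"
  shows "closed (elastic_set A V cm cp)" "convex (elastic_set A V cm cp)"
proof -
  have eq: "elastic_set A V cm cp =
    V \<inter> (\<Inter>j. {y. cm $ j \<le> axis j 1 \<bullet> (A *v y)} \<inter> {y. axis j 1 \<bullet> (A *v y) \<le> cp $ j})"
    by (auto simp: elastic_set_def)
  have "closed {y. cm $ j \<le> axis j 1 \<bullet> (A *v y)}" "closed {y. axis j 1 \<bullet> (A *v y) \<le> cp $ j}" for j
    by (intro closed_Collect_le continuous_intros matrix_vector_mult_linear_continuous_on)+
  then show "closed (elastic_set A V cm cp)"
    unfolding eq by (intro closed_Int closed_INT closed_subspace assms) auto
  have "{y. cm $ j \<le> axis j 1 \<bullet> (A *v y)} = {y. cm $ j \<le> (axis j 1 v* A) \<bullet> y}"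
    "{y. axis j 1 \<bullet> (A *v y) \<le> cp $ j} = {y. (axis j 1 v* A) \<bullet> y \<le> cp $ j}" for j
    by (simp_all add: dot_lmul_matrix)
  then show "convex (elastic_set A V cm cp)"
    unfolding eq
    by (intro convex_Int convex_INT subspace_imp_convex[OF assms])
       (simp_all add: convex_halfspace_le convex_halfspace_ge)
qed

text \<open>The origin of the constant in the bound on \<open>\<tau>d\<close>. The stresses of
  spring \<open>j\<close> at two points of the set lie in the same elastic interval, so coordinate
  \<open>j\<close> of the points differs by at most its length over \<open>a $ j\<close>, which is
  coordinate \<open>j\<close> of \<open>v\<close>.\<close>

lemma elastic_set_norm_A_le:
  assumes a: "\<forall>j. 0 < a $ j" and x: "x \<in> elastic_set (diag_matrix a) V cm cp" and y: "y \<in> elastic_set (diag_matrix a) V cm cp"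
  shows "norm_A (diag_matrix a) (x - y) \<le>
    norm_A (diag_matrix a) (matrix_inv (diag_matrix a) *v cp - matrix_inv (diag_matrix a) *v cm)"
proof -
  let ?A = "diag_matrix a"
  define v where "v = matrix_inv ?A *v cp - matrix_inv ?A *v cm"
  have "z = 0" if "?A *v z = 0" for z
  proof (rule vec_eq_iff[THEN iffD2], rule allI)
    fix j
    have "a $ j * z $ j = 0" using that diag_matrix_mult_component[of a z j] by simp
    then show "z $ j = 0 $ j" using a[rule_format, of j] by simp
  qed
  then have "invertible ?A" by (simp add: invertible_left_inverse matrix_left_invertible_ker)
  then have "?A *v v = cp - cm"
    by (simp add: v_def matrix_vector_mult_diff_distrib matrix_vector_mul_assoc matrix_inv_right)
  then have v: "a $ j * v $ j = cp $ j - cm $ j" for j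
    by (metis diag_matrix_mult_component vector_minus_component)
  have "norm (scale_sqrt a (x - y)) \<le> norm (scale_sqrt a v)"
  proof (rule norm_le_componentwise_cart)
    fix j
    have "\<bar>a $ j * x $ j - a $ j * y $ j\<bar> \<le> a $ j * v $ j"
    proof -
      have "cm $ j \<le> a $ j * x $ j" "a $ j * x $ j \<le> cp $ j" "cm $ j \<le> a $ j * y $ j" "a $ j * y $ j \<le> cp $ j"
        using x y by (simp_all add: elastic_set_def axis_inner_diag)
      then show ?thesis using v[of j] by linarith
    qed
    then have "a $ j * \<bar>x $ j - y $ j\<bar> \<le> a $ j * v $ j"
      using a[rule_format, of j] by (simp add: right_diff_distrib[symmetric] abs_mult)
    then have "\<bar>x $ j - y $ j\<bar> \<le> v $ j" using a[rule_format, of j] by simp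
    then show "norm (scale_sqrt a (x - y) $ j) \<le> norm (scale_sqrt a v $ j)"
      using a[rule_format, of j] by (simp add: scale_sqrt_def abs_mult mult_left_mono)
  qed
  then show ?thesis by (simp add: norm_A_diag[OF a] v_def)
qed

text \<open>The constraint of \<open>(\<alpha>, j)\<close> is active at \<open>y0\<close>, and
  \<alpha> times the normal of spring \<open>j\<close> points out of the set: at an upper limit
  stresses can only fall, at a lower limit only rise.\<close>

lemma combination_in_normal_cone:
  fixes nrm :: "'m \<Rightarrow> real^'m"
  assumes V: "subspace V" "\<And>j. nrm j \<in> V"
    and inner: "\<And>j y. y \<in> V \<Longrightarrow> nrm j \<bullet> (A *v y) = axis j 1 \<bullet> (A *v y)"
    and I0: "I0 \<subseteq> {-1, 1} \<times> UNIV" and y0: "y0 \<in> elastic_set A V cm cp"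
    and tight: "\<forall>(\<alpha>, j)\<in>I0. axis j 1 \<bullet> (A *v y0) = elastic_limit cm cp \<alpha> j"
    and \<mu>: "\<And>p. p \<in> I0 \<Longrightarrow> 0 \<le> \<mu> p"
  shows "(\<Sum>p\<in>I0. \<mu> p *\<^sub>R fst p *\<^sub>R nrm (snd p)) \<in> normal_cone_A A V (elastic_set A V cm cp) y0"
proof -
  have "(\<Sum>p\<in>I0. \<mu> p *\<^sub>R fst p *\<^sub>R nrm (snd p)) \<bullet> (A *v (\<xi> - y0)) \<le> 0"
    if \<xi>: "\<xi> \<in> elastic_set A V cm cp" for \<xi>
  proof -
    have d: "\<xi> - y0 \<in> V" using \<xi> y0 V(1) by (auto simp: elastic_set_def intro: subspace_diff)
    have "\<mu> p * (fst p * (axis (snd p) 1 \<bullet> (A *v (\<xi> - y0)))) \<le> 0" if p: "p \<in> I0" for p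
    proof (rule mult_nonneg_nonpos[OF \<mu>[OF p]])
      have "axis (snd p) 1 \<bullet> (A *v y0) = elastic_limit cm cp (fst p) (snd p)"
        using tight p by (auto simp: case_prod_beta)
      moreover have "cm $ snd p \<le> axis (snd p) 1 \<bullet> (A *v \<xi>)" "axis (snd p) 1 \<bullet> (A *v \<xi>) \<le> cp $ snd p"
        using \<xi> by (auto simp: elastic_set_def)
      \<comment> \<open>\<open>elastic_limit\<close> reads every sign other than 1 as the lower
        limit, so the sign has to be pinned down here.\<close>
      moreover have "fst p = -1 \<or> fst p = 1" using I0 p by auto
      ultimately show "fst p * (axis (snd p) 1 \<bullet> (A *v (\<xi> - y0))) \<le> 0"
        by (auto simp: elastic_limit_def matrix_vector_mult_diff_distrib inner_diff_right)
    qed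
    then show ?thesis
      by (simp add: inner_sum_left inner[OF d] mult.assoc sum_nonpos)
  qed
  moreover have "(\<Sum>p\<in>I0. \<mu> p *\<^sub>R fst p *\<^sub>R nrm (snd p)) \<in> V"
    by (intro subspace_sum subspace_scale V)
  ultimately show ?thesis using y0 by (simp add: normal_cone_A_def)
qed

text \<open>The derivatives of \<open>l\<close> and \<open>c\<close> are bound existentially under
  the almost-everywhere quantifiers, which for Lipschitz functions is no restriction. "The solution"
  through the corner is rendered as existence together with uniqueness from \<open>\<tau>d\<close>
  on.\<close>

theorem proposition4:
  fixes D :: "real^'n^'m"
    and a cm cp R :: "real^'m"
    and l :: "real \<Rightarrow> real"
    and Q :: "nat \<Rightarrow> real^'n"  \<comment> \<open>column \<open>i\<close> of the \<open>n \<times> (n - 2)\<close> matrix is \<open>Q i\<close>, for \<open>i < n - 2\<close>\<close>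
    and Vbasis :: "real^('k::finite option)^'m"
    and Dperp :: "real^'k^'m"
    and A :: "real^'m^'m"
    and V C F :: "(real^'m) set"
    and Ct :: "real \<Rightarrow> (real^'m) set"
    and c :: "real \<Rightarrow> real^'m"
    and nrm :: "'m \<Rightarrow> real^'m"
    and I0 :: "(real \<times> 'm) set"
    and y0 :: "real^'m"
    and \<tau>d \<epsilon>0 :: real
  assumes "2 \<le> CARD('n)" and "CARD('n) \<le> CARD('m)"
    and "CARD('k) = CARD('m) - CARD('n) + 1"
    and "rank D = CARD('n) - 1"
    and "\<forall>j. 0 < a $ j"
    and "\<forall>j. cm $ j \<le> cp $ j"
    and "rank (transpose D ** (columnvector R :: real^1^'m)) = 1"
    and "\<exists>L. L-lipschitz_on {0..} l"
    and A: "A = diag_matrix a"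
    and "dim ((\<lambda>i. D *v Q i) ` {..<CARD('n) - 2}) = CARD('n) - 2"
    and "\<forall>i<CARD('n) - 2. R \<bullet> (D *v Q i) = 0"
    and "inj (\<lambda>k. column k Vbasis)" and "independent (columns Vbasis)"
    and "\<forall>i<CARD('n) - 2. (D *v Q i) v* (A ** Vbasis) = 0"
    and "rank Dperp = CARD('m) - CARD('n) + 1"
    and "transpose Dperp ** D = 0"
    and V: "V = range (\<lambda>x. Vbasis *v x)"
    and nrm: "nrm = spring_normal R Dperp Vbasis"
    and c: "c = load_shift R Dperp Vbasis l"
    and C: "C = elastic_set A V cm cp"
    and Ct: "Ct = (\<lambda>t. (\<lambda>y. y + c t) ` C)"
    and "I0 \<subseteq> {-1, 1} \<times> UNIV"
    and "card I0 = CARD('m) - CARD('n) + 2"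
    and "\<exists>!y. y \<in> V \<and> (\<forall>(\<alpha>, j)\<in>I0. axis j 1 \<bullet> (A *v y) = elastic_limit cm cp \<alpha> j)"
    and "y0 \<in> V" and "\<forall>(\<alpha>, j)\<in>I0. axis j 1 \<bullet> (A *v y0) = elastic_limit cm cp \<alpha> j"
    and F: "F = {y0}"
    and "0 < \<tau>d"
    and "AE t\<in>{0..\<tau>d} in lebesgue. \<exists>l'. (l has_real_derivative l') (at t) \<and>
           l' *\<^sub>R axis None 1 \<in>
             nonneg_combinations ((\<lambda>(\<alpha>, j). P_matrix R Dperp *v (\<alpha> *\<^sub>R axis j 1)) ` I0)"
    and "\<forall>j. j \<notin> snd ` I0 \<longrightarrow>
           cm $ j < axis j 1 \<bullet> (A *v y0) \<and> axis j 1 \<bullet> (A *v y0) < cp $ j"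
    and "0 < \<epsilon>0"
    and "AE t\<in>{0..\<tau>d} in lebesgue. \<exists>c'. (c has_vector_derivative c') (at t) \<and>
           \<epsilon>0 \<le> Min ((\<lambda>p. dist_A A (- c') (span ((\<lambda>(\<alpha>, j). nrm j) ` (I0 - {p})))) ` I0)"
    and "\<tau>d \<ge> 1 / \<epsilon>0 * norm_A A (matrix_inv A *v cp - matrix_inv A *v cm)"
  shows
    "(AE t\<in>{0..\<tau>d} in lebesgue. \<exists>c'. (c has_vector_derivative c') (at t) \<and>
        (\<forall>y\<in>F. (\<lambda>x. - c' + x) ` (ball_A A V \<epsilon>0 \<inter> normal_cone_A A V F y)
                  \<subseteq> normal_cone_A A V C y)) \<and>
     (\<forall>y. sweeping_solution A V Ct 0 y \<and> y 0 \<in> Ct 0 \<longrightarrow>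
        y \<tau>d = y0 + c \<tau>d \<and> stress A c y \<tau>d = A *v y0) \<and>
     (\<forall>T\<ge>\<tau>d. (\<forall>t\<ge>0. c (t + T) = c t) \<longrightarrow>
        (\<exists>z. sweeping_solution A V Ct \<tau>d z \<and> z \<tau>d = y0 + c \<tau>d \<and>
             (\<forall>x. sweeping_solution A V Ct \<tau>d x \<and> x \<tau>d = y0 + c \<tau>d \<longrightarrow> (\<forall>t\<ge>\<tau>d. x t = z t)) \<and>
             one_period_stable A V Ct \<tau>d T z) \<and>
        (\<forall>y. sweeping_solution A V Ct 0 y \<and> y 0 \<in> Ct 0 \<longrightarrow>
           (\<forall>t\<ge>\<tau>d. stress A c y (t + T) = stress A c y t)) \<and>
        (\<forall>y1 y2. sweeping_solution A V Ct 0 y1 \<and> y1 0 \<in> Ct 0 \<and>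
                 sweeping_solution A V Ct 0 y2 \<and> y2 0 \<in> Ct 0 \<longrightarrow>
           (\<forall>t\<ge>\<tau>d. stress A c y1 t = stress A c y2 t)))"
proof -
  note apos = assms(5) and I0 = \<open>I0 \<subseteq> {-1, 1} \<times> UNIV\<close>
  have cmp: "cm $ j \<le> cp $ j" for j using \<open>\<forall>j. cm $ j \<le> cp $ j\<close> by blast
  have tight: "\<forall>(\<alpha>, j)\<in>I0. axis j 1 \<bullet> (A *v y0) = elastic_limit cm cp \<alpha> j" by fact
  have uniq: "\<exists>!y. y \<in> V \<and> (\<forall>(\<alpha>, j)\<in>I0. axis j 1 \<bullet> (A *v y) = elastic_limit cm cp \<alpha> j)" by fact
  have "card I0 > 0" using \<open>card I0 = CARD('m) - CARD('n) + 2\<close> by simp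
  then have finI: "finite I0" and neI: "I0 \<noteq> {}" by (auto simp: card_gt_0_iff)
  \<comment> \<open>\<open>G\<close> carries the cone condition from coordinates to
    \<open>V\<close>: it sends the \<open>P\<close>-image of \<open>axis j 1\<close> to the normal
    of spring \<open>j\<close>, and \<open>c\<close> is minus \<open>l\<close> times its value at
    \<open>axis None 1\<close>.\<close>
  define G where "G x = Vbasis *v (W_inv R Dperp Vbasis *v x)" for x
  have linG: "linear G"
    unfolding G_def by (rule linearI) (simp_all add: matrix_vector_right_distrib matrix_vector_mult_scaleR)
  have GV: "G x \<in> V" for x by (simp add: G_def V)
  have Vs: "subspace V"
    unfolding V by (rule linear_subspace_image[OF matrix_vector_mul_linear subspace_UNIV])
  have nrmG: "nrm j = G (P_matrix R Dperp *v axis j 1)" for j by (simp add: nrm spring_normal_def G_def)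
  have nV: "nrm j \<in> V" for j by (simp add: nrmG GV)
  have ker: "{v. P_matrix R Dperp *v v = 0} = span ((\<lambda>i. D *v Q i) ` {..<CARD('n) - 2})"
    by (rule P_matrix_kernel_eq_span) fact+
  have inner: "nrm j \<bullet> (A *v y) = axis j 1 \<bullet> (A *v y)" if "y \<in> V" for j y
    unfolding nrm A
  proof (rule spring_normal_inner[OF apos ker assms(12,13)])
    show "\<forall>i\<in>{..<CARD('n) - 2}. (D *v Q i) v* (diag_matrix a ** Vbasis) = 0"
      using assms(14) by (simp add: A)
    show "y \<in> range (\<lambda>x. Vbasis *v x)" using that by (simp add: V)
  qed
  define f where "f = (\<lambda>p. fst p *\<^sub>R nrm (snd p))"
  have sgn: "fst p \<noteq> 0" if "p \<in> I0" for p using I0 that by auto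
  \<comment> \<open>The distance hypothesis uses unsigned normals, the cone uses the signed ones in
    \<open>f\<close>; signs do not affect spans.\<close>
  have spanf: "span (f ` J) = span ((\<lambda>(\<alpha>, j). nrm j) ` J)" if "J \<subseteq> I0" for J
    unfolding f_def case_prod_beta by (rule span_scaled_image) (use sgn that in auto)
  have Vspan: "V \<subseteq> span (f ` I0)"
  proof (rule subspace_eq_span_if_separating[OF apos Vs])
    show "f ` I0 \<subseteq> V" using nV Vs by (auto simp: f_def intro: subspace_scale)
    fix y assume y: "y \<in> V" "\<forall>p\<in>I0. f p \<bullet> (diag_matrix a *v y) = 0"
    have "axis (snd p) 1 \<bullet> (A *v y) = 0" if "p \<in> I0" for p
      using y(2) that sgn[OF that] inner[OF y(1), of "snd p"] A by (auto simp: f_def)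
    \<comment> \<open>\<open>y0 + y\<close> satisfies the equations that determine the corner, hence
      equals it.\<close>
    then have "\<forall>(\<alpha>, j)\<in>I0. axis j 1 \<bullet> (A *v (y0 + y)) = elastic_limit cm cp \<alpha> j"
      using tight by (fastforce simp: matrix_vector_right_distrib inner_add_right)
    moreover have "y0 + y \<in> V" using \<open>y0 \<in> V\<close> y(1) Vs by (simp add: subspace_add)
    ultimately have "y0 + y = y0" using uniq \<open>y0 \<in> V\<close> tight by blast
    then show "y = 0" by simp
  qed
  have y0C: "y0 \<in> C"
  proof -
    have "cm $ j \<le> axis j 1 \<bullet> (A *v y0) \<and> axis j 1 \<bullet> (A *v y0) \<le> cp $ j" for j
    proof (cases "j \<in> snd ` I0")
      case True
      then obtain \<alpha> where "(\<alpha>, j) \<in> I0" by auto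
      then have "axis j 1 \<bullet> (A *v y0) = elastic_limit cm cp \<alpha> j" using tight by auto
      then show ?thesis using cmp[of j] by (auto simp: elastic_limit_def)
    next
      case False
      then show ?thesis using assms(30) by (simp add: less_imp_le)
    qed
    then show ?thesis using \<open>y0 \<in> V\<close> by (simp add: C elastic_set_def)
  qed
  have CV: "C \<subseteq> V" by (auto simp: C elastic_set_def)
  have Ccc: "closed C" "convex C" unfolding C by (rule elastic_set_closed_convex[OF Vs])+
  have cG: "c = (\<lambda>t. - (l t *\<^sub>R G (axis None 1)))"
    by (rule ext) (simp add: c load_shift_def G_def matrix_vector_mult_scaleR)
  have cV: "c t \<in> V" for t using GV Vs by (simp add: cG subspace_neg subspace_scale)
  obtain L0 where L0: "L0-lipschitz_on {0..} l" using \<open>\<exists>L. L-lipschitz_on {0..} l\<close> by blast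
  have lipc: "(L0 * norm (G (axis None 1)))-lipschitz_on {0..} c"
  proof (rule lipschitz_onI)
    fix s t :: real assume "s \<in> {0..}" "t \<in> {0..}"
    then have "dist (l s) (l t) \<le> L0 * dist s t" by (rule lipschitz_onD[OF L0])
    moreover have "dist (c s) (c t) = norm ((l t - l s) *\<^sub>R G (axis None 1))"
      by (simp add: cG dist_norm scaleR_left_diff_distrib)
    ultimately show "dist (c s) (c t) \<le> L0 * norm (G (axis None 1)) * dist s t"
      using mult_right_mono[of "dist (l s) (l t)" "L0 * dist s t" "norm (G (axis None 1))"]
      by (simp add: dist_real_def abs_minus_commute mult.commute mult.left_commute)
  qed (use lipschitz_on_nonneg[OF L0] in simp)
  have AE1: "AE t in lebesgue. (t \<in> {0..\<tau>d} \<longrightarrow> (\<exists>l'. (l has_real_derivative l') (at t) \<and>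
           l' *\<^sub>R axis None 1 \<in>
             nonneg_combinations ((\<lambda>(\<alpha>, j). P_matrix R Dperp *v (\<alpha> *\<^sub>R axis j 1)) ` I0))) \<and>
       (t \<in> {0..\<tau>d} \<longrightarrow> (\<exists>c'. (c has_vector_derivative c') (at t) \<and>
           \<epsilon>0 \<le> Min ((\<lambda>p. dist_A A (- c') (span ((\<lambda>(\<alpha>, j). nrm j) ` (I0 - {p})))) ` I0)))"
    by (rule eventually_conj) fact+
  have AE: "AE t\<in>{0..\<tau>d} in lebesgue. \<exists>c'. (c has_vector_derivative c') (at t) \<and>
        (\<forall>x\<in>ball_A A V \<epsilon>0. - c' + x \<in> normal_cone_A A V C y0)"
    using AE1
  proof (rule eventually_mono, intro impI)
    fix t assume *: "(t \<in> {0..\<tau>d} \<longrightarrow> (\<exists>l'. (l has_real_derivative l') (at t) \<and>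
           l' *\<^sub>R axis None 1 \<in>
             nonneg_combinations ((\<lambda>(\<alpha>, j). P_matrix R Dperp *v (\<alpha> *\<^sub>R axis j 1)) ` I0))) \<and>
       (t \<in> {0..\<tau>d} \<longrightarrow> (\<exists>c'. (c has_vector_derivative c') (at t) \<and>
           \<epsilon>0 \<le> Min ((\<lambda>p. dist_A A (- c') (span ((\<lambda>(\<alpha>, j). nrm j) ` (I0 - {p})))) ` I0)))"
      and t: "t \<in> {0..\<tau>d}"
    obtain l' where l': "(l has_real_derivative l') (at t)"
      "l' *\<^sub>R axis None 1 \<in> nonneg_combinations ((\<lambda>(\<alpha>, j). P_matrix R Dperp *v (\<alpha> *\<^sub>R axis j 1)) ` I0)"
      using * t by blast
    obtain c' where c': "(c has_vector_derivative c') (at t)"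
      "\<epsilon>0 \<le> Min ((\<lambda>p. dist_A A (- c') (span ((\<lambda>(\<alpha>, j). nrm j) ` (I0 - {p})))) ` I0)"
      using * t by blast
    \<comment> \<open>The cone hypothesis speaks of the derivative of \<open>l\<close> and the
      distance hypothesis of that of \<open>c\<close>; uniqueness of derivatives links the two at
      \<open>t\<close>.\<close>
    have "(c has_vector_derivative - (l' *\<^sub>R G (axis None 1))) (at t)"
      unfolding cG using l'(1)
      by (auto intro!: derivative_eq_intros simp: has_real_derivative_iff_has_vector_derivative[symmetric])
    then have c'_eq: "- c' = G (l' *\<^sub>R axis None 1)"
      using vector_derivative_unique_at[OF c'(1)] by (simp add: linear_cmul[OF linG])
    obtain r where r: "\<forall>p. 0 \<le> r p"
      "l' *\<^sub>R axis None 1 = (\<Sum>p\<in>I0. r p *\<^sub>R (case p of (\<alpha>, j) \<Rightarrow> P_matrix R Dperp *v (\<alpha> *\<^sub>R axis j 1)))"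
      by (rule nonneg_combinations_imageE[OF finI l'(2)])
    have c'_sum: "- c' = (\<Sum>p\<in>I0. r p *\<^sub>R f p)"
      unfolding c'_eq r(2)
      by (simp add: linear_sum[OF linG] linear_cmul[OF linG] case_prod_beta f_def nrmG matrix_vector_mult_scaleR)
    have dist: "\<epsilon>0 \<le> dist_A (diag_matrix a) (- c') (span (f ` (I0 - {p})))" if "p \<in> I0" for p
      using c'(2) that finI neI spanf[of "I0 - {p}"] A by (auto simp: Min_ge_iff)
    have "- c' + x \<in> normal_cone_A A V C y0" if x: "x \<in> ball_A A V \<epsilon>0" for x
    proof -
      have xs: "x \<in> span (f ` I0)" "norm_A (diag_matrix a) x \<le> \<epsilon>0"
        using x Vspan A by (auto simp: ball_A_def)
      obtain \<mu> where \<mu>: "\<forall>p\<in>I0. 0 \<le> \<mu> p" "- c' + x = (\<Sum>p\<in>I0. \<mu> p *\<^sub>R f p)"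
        by (rule diff_combination_in_cone[OF apos finI c'_sum r(1)[rule_format] dist xs \<open>0 < \<epsilon>0\<close>])
      show ?thesis
        unfolding \<mu>(2) f_def C
        by (rule combination_in_normal_cone[OF Vs nV inner I0 y0C[unfolded C] tight \<mu>(1)[rule_format]])
    qed
    then show "\<exists>c'. (c has_vector_derivative c') (at t) \<and> (\<forall>x\<in>ball_A A V \<epsilon>0. - c' + x \<in> normal_cone_A A V C y0)"
      using c'(1) by blast
  qed
  have far: "norm_A (diag_matrix a) (x - y0) \<le> \<epsilon>0 * \<tau>d" if "x \<in> C" for x
  proof -
    have "norm_A A (x - y0) \<le> norm_A A (matrix_inv A *v cp - matrix_inv A *v cm)"
      using elastic_set_norm_A_le[OF apos, of x V cm cp y0] that y0C by (simp add: C A)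
    also have "\<dots> \<le> \<epsilon>0 * \<tau>d"
      using assms(33) \<open>0 < \<epsilon>0\<close> by (simp add: field_simps)
    finally show ?thesis by (simp add: A)
  qed
  have reach: "y \<tau>d = y0 + c \<tau>d" if "sweeping_solution A V Ct 0 y" for y
    by (rule sweeping_solution_reaches_corner[OF apos _ lipc CV Vs y0C _ _ AE[unfolded A] far])
       (use that \<open>0 < \<tau>d\<close> \<open>0 < \<epsilon>0\<close> in \<open>auto simp: A Ct\<close>)
  obtain z where z: "sweeping_solution A V Ct \<tau>d z" "z \<tau>d = y0 + c \<tau>d"
  proof (rule sweeping_solution_exists[OF apos Vs Ccc CV _ cV y0C])
    show "(L0 * norm (G (axis None 1)))-lipschitz_on {\<tau>d..} c"
      by (rule lipschitz_on_subset[OF lipc]) (use \<open>0 < \<tau>d\<close> in auto)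
  qed (simp add: A Ct)
  have uniq_z: "x t = z t" if "sweeping_solution A V Ct \<tau>d x" "x \<tau>d = y0 + c \<tau>d" "t \<ge> \<tau>d" for x t
    using sweeping_solution_unique[OF apos that(1)[unfolded A] z(1)[unfolded A] _ that(3)] that(2) z(2) by simp
  have after: "y t = z t" if y: "sweeping_solution A V Ct 0 y" and t: "t \<ge> \<tau>d" for y t
  proof -
    have "sweeping_solution A V Ct \<tau>d (\<lambda>t. y (t + 0))"
      by (rule sweeping_solution_shift[OF y]) (use \<open>0 < \<tau>d\<close> in auto)
    then show ?thesis using uniq_z[of y t] reach[OF y] t by simp
  qed
  \<comment> \<open>Because \<open>T \<ge> \<tau>d\<close>, the translate of \<open>z\<close> solves
    the process from time 0. It therefore passes through the same corner at \<open>\<tau>d\<close>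
    and agrees with \<open>z\<close> afterwards.\<close>
  have per: "z (t + T) = z t" if T: "\<tau>d \<le> T" "\<forall>t\<ge>0. c (t + T) = c t" and t: "\<tau>d \<le> t" for T t
  proof -
    have "sweeping_solution A V Ct 0 (\<lambda>t. z (t + T))"
      by (rule sweeping_solution_shift[OF z(1)]) (use T in \<open>auto simp: Ct\<close>)
    then show ?thesis by (rule after) (rule t)
  qed
  \<comment> \<open>The normal cone of the one-point set \<open>F\<close> at \<open>y0\<close> is
    all of \<open>V\<close>, so the intersection is the full ball, for which \<open>AE\<close> was
    proved.\<close>
  have concl1: "AE t\<in>{0..\<tau>d} in lebesgue. \<exists>c'. (c has_vector_derivative c') (at t) \<and>
        (\<forall>y\<in>F. (\<lambda>x. - c' + x) ` (ball_A A V \<epsilon>0 \<inter> normal_cone_A A V F y) \<subseteq> normal_cone_A A V C y)"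
    using AE by (rule eventually_mono) (auto simp: F)
  have concl2: "y \<tau>d = y0 + c \<tau>d \<and> stress A c y \<tau>d = A *v y0" if "sweeping_solution A V Ct 0 y" for y
    using reach[OF that] by (simp add: stress_def)
  have concl3: "\<exists>z. sweeping_solution A V Ct \<tau>d z \<and> z \<tau>d = y0 + c \<tau>d \<and>
             (\<forall>x. sweeping_solution A V Ct \<tau>d x \<and> x \<tau>d = y0 + c \<tau>d \<longrightarrow> (\<forall>t\<ge>\<tau>d. x t = z t)) \<and>
             one_period_stable A V Ct \<tau>d T z"
    if T: "\<tau>d \<le> T" "\<forall>t\<ge>0. c (t + T) = c t" for T
  proof (intro exI[of _ z] conjI z)
    show "\<forall>x. sweeping_solution A V Ct \<tau>d x \<and> x \<tau>d = y0 + c \<tau>d \<longrightarrow> (\<forall>t\<ge>\<tau>d. x t = z t)"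
      using uniq_z by blast
    have "y t = z t" if "sweeping_solution A V Ct 0 y" "t \<ge> T" for y t
      using after[OF that(1)] that(2) T(1) by simp
    then show "one_period_stable A V Ct \<tau>d T z"
      unfolding one_period_stable_def using per[OF T] by blast
  qed
  have concl4: "stress A c y (t + T) = stress A c y t"
    if "\<tau>d \<le> T" "\<forall>t\<ge>0. c (t + T) = c t" "sweeping_solution A V Ct 0 y" "\<tau>d \<le> t" for T y t
    using after[OF that(3), of t] after[OF that(3), of "t + T"] per[OF that(1,2,4)] that \<open>0 < \<tau>d\<close>
    by (simp add: stress_def)
  have concl5: "stress A c y1 t = stress A c y2 t"
    if "sweeping_solution A V Ct 0 y1" "sweeping_solution A V Ct 0 y2" "\<tau>d \<le> t" for y1 y2 t
    using after[OF that(1,3)] after[OF that(2,3)] by (simp add: stress_def)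
  show ?thesis
    by (intro conjI allI impI concl1) (use concl2 concl3 concl4 concl5 in blast)+
qed

end
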